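(* Assume (A), (R), (S) and let $c^{\mathrm{in}}=(c^{\mathrm{in}}_k)_{k\in\mathbb N}\in\ell^1_1$. Then there exists at least one global solution $c=(c_k)_{k\in\mathbb N}$ of (E) with initial condition $c^{\mathrm{in}}$.
   Context: Throughout, $\mathbb N=\{1,2,\dots\}$. We consider the forced discrete coagulation equation $$\frac{d}{dt}c_k=\frac12\sum_{\ell=1}^{k-1}a_{k-\ell,\ell}c_{k-\ell}c_\ell-c_k\sum_{\ell=1}^{\infty}a_{k,\ell}c_\ell+s_k-r_kc_k,\qquad k\in\mathbb N,\tag{E}$$ with real coefficients satisfying the standing assumptions: (A) $a_{k,\ell}=a_{\ell,k}$ and $0\le a_{k,\ell}\le A_*(k^\alpha\ell^\beta+k^\beta\ell^\alpha)$ for all $k,\ell\in\mathbb N$, with constants $A_*>0$, $\alpha,\beta\in[0,1]$, $\alpha\le\beta$; (R) $r_k\ge R_*k^\gamma$ for all $k\in\mathbb N$, with $R_*>0$ and $\gamma>\max\{0,\alpha+\beta-1\}$; (S) $s_k\ge 0$ for all $k$, and for every $\mu\ge0$ there is $\mathfrak s_\mu>0$ with $\sum_{k\ge1}k^\mu s_k\le\mathfrak s_\mu$. Write $\widehat A_*=A_*/R_*$ and $\widehat{\mathfrak s}_\mu=\mathfrak s_\mu/R_*$. For $\mu\ge0$, $\ell^1_\mu$ is the set of sequences $(c_k)_{k\in\mathbb N}$ with $c_k\in[0,\infty)$ and $\sum_k k^\mu c_k<\infty$; for sequences $x$ we write $\|x\|_{\ell^1_\mu}=\sum_k k^\mu|x_k|$.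 Solution: a sequence $c=(c_k)_{k\in\mathbb N}$ of continuous functions $c_k:[0,T)\to[0,\infty)$ is a solution of (E) on $[0,T)$ with initial condition $c^{\mathrm{in}}\in\ell^1_1$ if (i) for each $k$, (E) holds for all $t\in(0,T)$; (ii) for each $\mu\ge1$, $c\in L^\infty([0,T),\ell^1_1)\cap C^1((0,T),\ell^1_\mu)$; (iii) $c_k(0)=c_k^{\mathrm{in}}$ for all $k$. It is a global solution if $T=\infty$; an equilibrium (stationary solution) is a global solution not depending on $t$. Moments: $\mathfrak m_\mu(t)=\sum_k k^\mu c_k(t)$, $\mathfrak m_1^{\mathrm{in}}=\sum_k k c_k^{\mathrm{in}}$. *)

theory Defs
  imports "HOL-Analysis.Analysis"
begin

text \<open>Sequences are functions nat => real; only indices k >= 1 are meaningful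
  (the index set is N = {1,2,...}); the value at index 0 is ignored.\<close>

definition wsummable :: "real \<Rightarrow> (nat \<Rightarrow> real) \<Rightarrow> bool" where
  "wsummable \<mu> x \<longleftrightarrow> (\<lambda>k. real k powr \<mu> * \<bar>x k\<bar>) summable_on {1..}"

definition wnorm :: "real \<Rightarrow> (nat \<Rightarrow> real) \<Rightarrow> real" where
  "wnorm \<mu> x = (\<Sum>\<^sub>\<infinity>k\<in>{1..}. real k powr \<mu> * \<bar>x k\<bar>)"

definition in_ell1 :: "real \<Rightarrow> (nat \<Rightarrow> real) \<Rightarrow> bool" where
  "in_ell1 \<mu> x \<longleftrightarrow> (\<forall>k\<ge>1. x k \<ge> 0) \<and> wsummable \<mu> x"

definition coag_rhs ::
  "(nat \<Rightarrow> nat \<Rightarrow> real) \<Rightarrow> (nat \<Rightarrow> real) \<Rightarrow> (nat \<Rightarrow> real) \<Rightarrow> (nat \<Rightarrow> real) \<Rightarrow> nat \<Rightarrow> real" where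
  "coag_rhs a s r x k =
     (1/2) * (\<Sum>l\<in>{1..<k}. a (k - l) l * x (k - l) * x l)
     - x k * (\<Sum>\<^sub>\<infinity>l\<in>{1..}. a k l * x l)
     + s k - r k * x k"

definition C1_ell1 :: "real \<Rightarrow> (nat \<Rightarrow> real \<Rightarrow> real) \<Rightarrow> bool" where
  "C1_ell1 \<mu> c \<longleftrightarrow>
     (\<exists>d :: real \<Rightarrow> nat \<Rightarrow> real.
        \<forall>t>0. wsummable \<mu> (\<lambda>k. c k t) \<and> wsummable \<mu> (d t)
          \<and> ((\<lambda>h. wnorm \<mu> (\<lambda>k. (c k (t + h) - c k t) / h - d t k)) \<longlongrightarrow> 0) (at 0)
          \<and> ((\<lambda>\<tau>. wnorm \<mu> (\<lambda>k. d \<tau> k - d t k)) \<longlongrightarrow> 0) (at t))"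

definition global_solution ::
  "(nat \<Rightarrow> nat \<Rightarrow> real) \<Rightarrow> (nat \<Rightarrow> real) \<Rightarrow> (nat \<Rightarrow> real) \<Rightarrow> (nat \<Rightarrow> real)
    \<Rightarrow> (nat \<Rightarrow> real \<Rightarrow> real) \<Rightarrow> bool" where
  "global_solution a s r cin c \<longleftrightarrow>
     (\<forall>k\<ge>1. continuous_on {0..} (c k) \<and> (\<forall>t\<ge>0. c k t \<ge> 0))
   \<and> (\<forall>k\<ge>1. \<forall>t>0. (c k has_real_derivative coag_rhs a s r (\<lambda>j. c j t) k) (at t))
   \<and> (\<exists>M. \<forall>t\<ge>0. wsummable 1 (\<lambda>k. c k t) \<and> wnorm 1 (\<lambda>k. c k t) \<le> M)
   \<and> (\<forall>\<mu>\<ge>1. C1_ell1 \<mu> c)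
   \<and> (\<forall>k\<ge>1. c k 0 = cin k)"

end

theory Submission
  imports Defs
begin

text \<open>
  Truncate the system to sizes at most n, keeping only coagulation events k + l \<le> n, and discretise
  time by the explicit Euler scheme with a step so small (depending on n) that nonnegativity and the
  mass bound are preserved. Moments are linear functionals of the state, so each of them satisfies
  the same inequality along the scheme as along the equation. In a pair l \<le> k the rate is at most
  a multiple of \<open>k powr (\<alpha> + \<beta>)\<close>, so the gain of the moment of order \<open>\<mu>\<close> is at most a multiple of
  the mass times the moment of order \<open>\<mu> - 1 + \<alpha> + \<beta>\<close>, which is below the order \<open>\<mu> + \<gamma>\<close> controlled by
  removal. Integrating this over a short time window gains \<open>\<gamma>\<close> orders; iterating, all
  moments are bounded on \<open>[t0, \<infinity>)\<close> for every \<open>t0 > 0\<close>, uniformly in n. A limit along a filter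
  finer than \<open>sequentially\<close> then solves the equation, and the fast decay in k yields
  \<open>C\<^sup>1\<close> regularity in every weighted space. No upper bound on r is available; the removal term is
  nevertheless controlled because \<open>c\<^sub>k\<close> relaxes at rate \<open>r\<^sub>k\<close> to a value of order \<open>gain / r\<^sub>k\<close>.
\<close>

section \<open>Series, power inequalities, compactness and a comparison estimate\<close>

lemma infsum_from_1_eq_suminf:
  fixes f :: "nat \<Rightarrow> real"
  assumes "summable (\<lambda>k. norm (if k \<ge> 1 then f k else 0))"
  shows "(\<Sum>\<^sub>\<infinity>k\<in>{1..}. f k) = (\<Sum>k. if k \<ge> 1 then f k else 0)"
proof -
  have "(\<Sum>\<^sub>\<infinity>k\<in>{1..}. f k) = (\<Sum>\<^sub>\<infinity>k. if k \<ge> 1 then f k else 0)"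
    by (rule infsum_cong_neutral) auto
  also have "\<dots> = (\<Sum>k. if k \<ge> 1 then f k else 0)"
    using norm_summable_imp_has_sum[OF assms summable_sums[OF summable_norm_cancel[OF assms]]]
    by (rule infsumI)
  finally show ?thesis .
qed

text \<open>Dominated convergence for series: \<open>tannerys_theorem\<close> applied after padding
  index 0 with zero. The filter is left general because limits are taken at infinity, at a fixed
  time and at increment 0.\<close>

lemma infsum_dominated_tendsto:
  fixes f :: "'b \<Rightarrow> nat \<Rightarrow> real"
  assumes lim: "\<And>k. k \<ge> 1 \<Longrightarrow> ((\<lambda>x. f x k) \<longlongrightarrow> g k) F"
    and bound: "eventually (\<lambda>x. \<forall>k\<ge>1. \<bar>f x k\<bar> \<le> B k) F"
    and B: "B summable_on {1..}"
  shows "((\<lambda>x. \<Sum>\<^sub>\<infinity>k\<in>{1..}. f x k) \<longlongrightarrow> (\<Sum>\<^sub>\<infinity>k\<in>{1..}. g k)) F"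
proof (cases "F = bot")
  case False
  define f' where "f' = (\<lambda>k x. if k \<ge> 1 then f x k else 0)"
  define B' where "B' = (\<lambda>k::nat. if k \<ge> 1 then B k else 0)"
  have "B' summable_on UNIV \<longleftrightarrow> B summable_on {1..}"
    by (rule summable_on_cong_neutral) (auto simp: B'_def)
  then have sB: "summable B'"
    using B summable_on_imp_summable by blast
  have "eventually (\<lambda>(k,x). norm (f' k x) \<le> B' k) (at_top \<times>\<^sub>F F)"
    using eventually_prod2[of "at_top :: nat filter" "\<lambda>x. \<forall>k\<ge>1. \<bar>f x k\<bar> \<le> B k" F] bound
    by (auto simp: f'_def B'_def elim!: eventually_mono)
  moreover have "\<And>k. ((\<lambda>x. f' k x) \<longlongrightarrow> (if k \<ge> 1 then g k else 0)) F"
    using lim by (auto simp: f'_def)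
  ultimately have T: "eventually (\<lambda>x. summable (\<lambda>k. norm (f' k x))) F"
    "summable (\<lambda>k. norm (if k \<ge> 1 then g k else 0))"
    "((\<lambda>x. suminf (\<lambda>k. f' k x)) \<longlongrightarrow> suminf (\<lambda>k. if k \<ge> 1 then g k else 0)) F"
    using tannerys_theorem[of f' "\<lambda>k. if k \<ge> 1 then g k else 0" F B'] sB False by auto
  have "eventually (\<lambda>x. suminf (\<lambda>k. f' k x) = (\<Sum>\<^sub>\<infinity>k\<in>{1..}. f x k)) F"
    using T(1)
  proof eventually_elim
    case (elim x)
    then show ?case
      using infsum_from_1_eq_suminf[of "f x"] by (simp add: f'_def)
  qed
  then show ?thesis
    using T(3) infsum_from_1_eq_suminf[OF T(2)] by (simp add: tendsto_cong)
qed auto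

text \<open>The common majorant of all later series: a bound of order \<mu> + 2, uniform in
  \<open>k\<close>, gives summability of order \<mu>.\<close>

lemma summable_on_inverse_square: "(\<lambda>k. C * real k powr -2) summable_on {1..}"
proof -
  have "summable (\<lambda>k. \<bar>C\<bar> * real k powr -2)"
    by (intro summable_mult) (simp add: summable_real_powr_iff)
  moreover have "(\<lambda>k. norm (C * real k powr -2)) = (\<lambda>k. \<bar>C\<bar> * real k powr -2)"
    by (rule ext) (simp only: real_norm_def abs_mult abs_of_nonneg[OF powr_ge_zero])
  ultimately have "(\<lambda>k. C * real k powr -2) summable_on UNIV"
    by (intro norm_summable_imp_summable_on) simp
  then show ?thesis
    by (rule summable_on_subset_banach) auto
qed

text \<open>The mean value theorem on \<open>[x, x + y]\<close> gives an intermediate point below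
  \<open>2 * x\<close>, and the term \<open>y powr \<mu>\<close> is discarded. The larger of the two
  sizes carries the power \<mu> - 1 and the smaller one enters linearly.\<close>

lemma powr_add_diff_le:
  fixes x y \<mu> :: real
  assumes "0 < y" "y \<le> x" "1 \<le> \<mu>"
  shows "(x + y) powr \<mu> - x powr \<mu> - y powr \<mu> \<le> \<mu> * 2 powr \<mu> * (x powr (\<mu> - 1) * y)"
proof -
  have "\<exists>z. x < z \<and> z < x + y \<and> (x + y) powr \<mu> - x powr \<mu> = (x + y - x) * (\<mu> * z powr (\<mu> - 1))"
    using assms by (intro MVT2 has_real_derivative_powr) auto
  then obtain z where z: "x < z" "z < x + y"
    and eq: "(x + y) powr \<mu> - x powr \<mu> = (x + y - x) * (\<mu> * z powr (\<mu> - 1))"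
    by blast
  have "z powr (\<mu> - 1) \<le> (2 * x) powr (\<mu> - 1)"
    using z assms by (intro powr_mono2) auto
  also have "\<dots> = 2 powr (\<mu> - 1) * x powr (\<mu> - 1)"
    using assms by (simp add: powr_mult)
  also have "\<dots> \<le> 2 powr \<mu> * x powr (\<mu> - 1)"
    by (intro mult_right_mono powr_mono) auto
  finally have "y * (\<mu> * z powr (\<mu> - 1)) \<le> y * (\<mu> * (2 powr \<mu> * x powr (\<mu> - 1)))"
    using assms by (intro mult_left_mono) auto
  also have "\<dots> = \<mu> * 2 powr \<mu> * (x powr (\<mu> - 1) * y)"
    by simp
  finally have "(x + y) powr \<mu> - x powr \<mu> \<le> \<mu> * 2 powr \<mu> * (x powr (\<mu> - 1) * y)"
    using eq by simp
  moreover have "0 \<le> y powr \<mu>" by simp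
  ultimately show ?thesis by linarith
qed

text \<open>Sizes are split at the threshold where \<open>k powr (p - q)\<close> reaches 1 /
  \<epsilon>. Above it the term of order \<open>p\<close> dominates; below it \<open>k\<close> is
  bounded, hence so is \<open>k powr q\<close>. The remainder is linear in \<open>k\<close> so that,
  summed against concentrations, it becomes a multiple of the mass.\<close>

lemma powr_interpolation:
  fixes p q \<epsilon> :: real
  assumes "0 \<le> q" "q < p" "0 < \<epsilon>"
  shows "\<exists>K\<ge>0. \<forall>k\<ge>1. real k powr q \<le> \<epsilon> * real k powr p + K * real k"
proof (intro exI conjI allI impI)
  define K where "K = ((1/\<epsilon>) powr (1/(p-q))) powr q"
  show "0 \<le> K" by (simp add: K_def)
  fix k :: nat assume k: "1 \<le> k"
  show "real k powr q \<le> \<epsilon> * real k powr p + K * real k"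
  proof (cases "1/\<epsilon> \<le> real k powr (p - q)")
    case True
    have "real k powr q = \<epsilon> * ((1/\<epsilon>) * real k powr q)"
      using assms by simp
    also have "\<dots> \<le> \<epsilon> * (real k powr (p - q) * real k powr q)"
      using True assms by (intro mult_left_mono mult_right_mono) auto
    also have "\<dots> = \<epsilon> * real k powr p"
      by (simp flip: powr_add)
    also have "\<dots> \<le> \<epsilon> * real k powr p + K * real k"
      by (simp add: K_def)
    finally show ?thesis .
  next
    case False
    have "real k = (real k powr (p - q)) powr (1/(p-q))"
      using assms k by (simp add: powr_powr)
    also have "\<dots> \<le> (1/\<epsilon>) powr (1/(p-q))"
      using False assms by (intro powr_mono2) auto
    finally have "real k powr q \<le> K"
      unfolding K_def using assms by (intro powr_mono2) auto
    also have "K \<le> K * real k"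
      using k by (simp add: K_def mult_le_cancel_left1)
    also have "\<dots> \<le> \<epsilon> * real k powr p + K * real k"
      using assms by simp
    finally show ?thesis .
  qed
qed

text \<open>Pulls a cluster point back to the index set: with \<open>F\<close> its neighbourhood
  filter, the infimum is a nontrivial filter finer than \<open>G\<close> along which
  \<open>f\<close> converges to it.\<close>

lemma inf_filtercomap_neq_bot:
  assumes "inf F (filtermap f G) \<noteq> bot"
  shows "inf (filtercomap f F) G \<noteq> bot"
proof
  assume "inf (filtercomap f F) G = bot"
  then have "eventually (\<lambda>_. False) (inf (filtercomap f F) G)" by simp
  then obtain P Q where P: "eventually P (filtercomap f F)" and Q: "eventually Q G" and PQ: "\<And>x. P x \<Longrightarrow> \<not> Q x"
    unfolding eventually_inf by blast
  obtain P' where P': "eventually P' F" "\<And>x. P' (f x) \<Longrightarrow> P x"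
    using P unfolding eventually_filtercomap by blast
  have "eventually (\<lambda>y. \<not> P' y) (filtermap f G)"
    unfolding eventually_filtermap using Q by eventually_elim (use P'(2) PQ in blast)
  then have "eventually (\<lambda>_. False) (inf F (filtermap f G))"
    unfolding eventually_inf using P'(1) by blast
  then show False using assms by (simp add: eventually_False)
qed

\<comment> \<open>Tychonoff gives a pointwise limit along a filter for any index type, so no diagonal subsequence is needed.\<close>
lemma bounded_functions_cluster:
  fixes f :: "nat \<Rightarrow> 'i \<Rightarrow> real"
  assumes "\<And>n i. f n i \<in> {a..b}"
  shows "\<exists>Fl c. Fl \<noteq> bot \<and> Fl \<le> sequentially \<and> (\<forall>i. ((\<lambda>n. f n i) \<longlongrightarrow> c i) Fl)"
proof -
  have "compact (PiE UNIV (\<lambda>_::'i. {a..b}))"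
    using compactin_PiE[of "\<lambda>_::'i. euclideanreal" UNIV "\<lambda>_. {a..b}"]
    by (simp add: euclidean_product_topology)
  moreover have "filtermap f sequentially \<noteq> bot" by (simp add: filtermap_bot_iff)
  moreover have "eventually (\<lambda>x. x \<in> PiE UNIV (\<lambda>_::'i. {a..b})) (filtermap f sequentially)"
    using assms unfolding eventually_filtermap by (intro always_eventually) (auto simp: PiE_UNIV_domain)
  ultimately obtain c where "inf (nhds c) (filtermap f sequentially) \<noteq> bot"
    unfolding compact_filter by blast
  then have "inf (filtercomap f (nhds c)) sequentially \<noteq> bot" (is "?Fl \<noteq> bot")
    by (rule inf_filtercomap_neq_bot)
  moreover have "((\<lambda>n. f n i) \<longlongrightarrow> c i) ?Fl" for i
  proof -
    have "filterlim f (nhds c) ?Fl"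
      by (rule filterlim_mono[OF filterlim_filtercomap]) auto
    moreover have "((\<lambda>g. g i) \<longlongrightarrow> c i) (nhds c)"
    proof (rule topological_tendstoI)
      fix V :: "real set" assume V: "open V" "c i \<in> V"
      have "open ((\<lambda>g::'i \<Rightarrow> real. g i) -` V)"
        by (rule open_vimage[OF V(1) continuous_on_product_coordinates])
      then show "eventually (\<lambda>g. g i \<in> V) (nhds c)"
        using V(2) unfolding eventually_nhds by blast
    qed
    ultimately show ?thesis
      by (rule filterlim_compose[rotated])
  qed
  ultimately show ?thesis by (meson inf_le2)
qed

lemma summable_on_from_partial_sums:
  fixes f :: "nat \<Rightarrow> real"
  assumes "\<And>k. k \<ge> 1 \<Longrightarrow> 0 \<le> f k" "\<And>N. (\<Sum>k=1..N. f k) \<le> B"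
  shows "f summable_on {1..}" "(\<Sum>\<^sub>\<infinity>k\<in>{1..}. f k) \<le> B"
proof -
  have *: "sum f X \<le> B" if "finite X" "X \<subseteq> {1..}" for X
  proof -
    have "sum f X \<le> sum f {1..Max (insert 0 X)}"
      using that assms(1) by (intro sum_mono2) auto
    then show ?thesis using assms(2) order_trans by blast
  qed
  show "f summable_on {1..}"
    using assms(1) * by (intro nonneg_bdd_above_summable_on) (auto intro!: bdd_aboveI[of _ B])
  then show "(\<Sum>\<^sub>\<infinity>k\<in>{1..}. f k) \<le> B"
    using * by (intro infsum_le_finite_sums) auto
qed

lemma partial_sums_tendsto_infsum:
  fixes f :: "nat \<Rightarrow> real"
  assumes "f summable_on {1..}" "\<And>k. k \<ge> 1 \<Longrightarrow> 0 \<le> f k"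
  shows "(\<lambda>m. \<Sum>k=1..m. f k) \<longlonglongrightarrow> (\<Sum>\<^sub>\<infinity>k\<in>{1..}. f k)"
proof -
  have "(\<lambda>m. \<Sum>\<^sub>\<infinity>k\<in>{1..}. if k \<le> m then f k else 0) \<longlonglongrightarrow> (\<Sum>\<^sub>\<infinity>k\<in>{1..}. f k)"
  proof (rule infsum_dominated_tendsto[where B = f])
    fix k :: nat
    have "eventually (\<lambda>m. f k = (if k \<le> m then f k else 0)) sequentially"
      using eventually_ge_at_top[of k] by eventually_elim simp
    then show "(\<lambda>m. if k \<le> m then f k else 0) \<longlonglongrightarrow> f k"
      by (rule tendsto_eventually[OF eventually_mono]) auto
  qed (use assms in auto)
  moreover have "(\<Sum>\<^sub>\<infinity>k\<in>{1..}. if k \<le> m then f k else 0) = (\<Sum>k=1..m. f k)" for m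
  proof -
    have "(\<Sum>\<^sub>\<infinity>k\<in>{1..}. if k \<le> m then f k else 0) = (\<Sum>\<^sub>\<infinity>k\<in>{1..m}. f k)"
      by (rule infsum_cong_neutral) auto
    then show ?thesis by simp
  qed
  ultimately show ?thesis by simp
qed

text \<open>The integrating factor gives \<rho> f(t) \<le> G + f(t0) \<rho> exp(-\<rho> (t - t0)),
  and \<rho> exp(-\<rho> (t - t0)) \<le> 1 / (t - t0). The resulting bound on the product \<rho>
  f(t) does not involve \<rho>, so it can be used with \<rho> = \<open>r k\<close>, however
  large.\<close>

lemma relaxation_bound:
  fixes f f' :: "real \<Rightarrow> real"
  assumes deriv: "\<And>x. t0 \<le> x \<Longrightarrow> (f has_real_derivative f' x) (at x)"
    and le: "\<And>x. t0 \<le> x \<Longrightarrow> f' x \<le> G - \<rho> * f x"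
    and "0 < \<rho>" "0 \<le> G" "0 \<le> f t0" "t0 < t"
  shows "\<rho> * f t \<le> G + f t0 / (t - t0)"
proof -
  let ?\<phi> = "\<lambda>x. (f x - G / \<rho>) * exp (\<rho> * (x - t0))"
  have "?\<phi> t \<le> ?\<phi> t0"
  proof (rule DERIV_nonpos_imp_nonincreasing[of t0 t ?\<phi>])
    fix x assume x: "t0 \<le> x" "x \<le> t"
    have "(?\<phi> has_real_derivative (f' x - (G - \<rho> * f x)) * exp (\<rho> * (x - t0))) (at x)"
      using assms(3) by (auto intro!: derivative_eq_intros deriv[OF x(1)] simp: field_simps)
    moreover have "(f' x - (G - \<rho> * f x)) * exp (\<rho> * (x - t0)) \<le> 0"
      using le[OF x(1)] by (intro mult_nonpos_nonneg) auto
    ultimately show "\<exists>y. (?\<phi> has_real_derivative y) (at x) \<and> y \<le> 0" by blast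
  qed (use assms in auto)
  also have "\<dots> \<le> f t0" using assms by simp
  finally have "f t - G / \<rho> \<le> f t0 / exp (\<rho> * (t - t0))"
    by (simp only: pos_le_divide_eq exp_gt_zero)
  also have "\<dots> = f t0 * exp (- (\<rho> * (t - t0)))"
    by (simp only: exp_minus divide_inverse)
  finally have "\<rho> * (f t - G / \<rho>) \<le> \<rho> * (f t0 * exp (- (\<rho> * (t - t0))))"
    using assms by (intro mult_left_mono) auto
  moreover have "\<rho> * exp (- (\<rho> * (t - t0))) \<le> 1 / (t - t0)"
  proof -
    have "\<rho> * (t - t0) \<le> exp (\<rho> * (t - t0))"
      using exp_ge_add_one_self[of "\<rho> * (t - t0)"] by linarith
    then have "\<rho> * (t - t0) * exp (- (\<rho> * (t - t0))) \<le> exp (\<rho> * (t - t0)) * exp (- (\<rho> * (t - t0)))"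
      by (rule mult_right_mono) simp
    also have "\<dots> = 1" by (simp only: exp_minus_inverse)
    finally have "\<rho> * exp (- (\<rho> * (t - t0))) * (t - t0) \<le> 1" by (simp only: mult_ac)
    then show ?thesis using assms by (simp only: pos_le_divide_eq diff_gt_0_iff_gt)
  qed
  then have "f t0 * (\<rho> * exp (- (\<rho> * (t - t0)))) \<le> f t0 * (1 / (t - t0))"
    using assms by (intro mult_left_mono) auto
  ultimately show ?thesis using assms by (simp add: right_diff_distrib mult_ac)
qed

subsection \<open>Weak form of the truncated coagulation operator\<close>

text \<open>The ordered pairs whose coagulation survives truncation. Summing over it by rows
  produces the loss terms, by diagonals the gain terms.\<close>

definition triangle :: "nat \<Rightarrow> (nat \<times> nat) set" where
  "triangle n = {(k, l). 1 \<le> k \<and> 1 \<le> l \<and> k + l \<le> n}"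

lemma finite_triangle [simp]: "finite (triangle n)"
  by (rule finite_subset[of _ "{..n} \<times> {..n}"]) (auto simp: triangle_def)

lemma sum_triangle_swap:
  "(\<Sum>(k,l)\<in>triangle n. f k l) = (\<Sum>(k,l)\<in>triangle n. f l k)"
  by (rule sum.reindex_bij_witness[of _ "\<lambda>(k,l). (l,k)" "\<lambda>(k,l). (l,k)"])
     (auto simp: triangle_def)

lemma sum_triangle_rows:
  "(\<Sum>k=1..n. \<Sum>l=1..n-k. f k l) = (\<Sum>(k,l)\<in>triangle n. f k l)"
  by (subst sum.Sigma) (auto simp: triangle_def intro!: sum.cong)

lemma sum_triangle_diagonals:
  "(\<Sum>k=1..n. \<Sum>l\<in>{1..<k}. f (k - l) l) = (\<Sum>(k,l)\<in>triangle n. f k l)"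
proof -
  have "(\<Sum>k=1..n. \<Sum>l\<in>{1..<k}. f (k - l) l) = (\<Sum>(k,l)\<in>Sigma {1..n} (\<lambda>k. {1..<k}). f (k - l) l)"
    by (rule sum.Sigma) auto
  also have "\<dots> = (\<Sum>(k,l)\<in>triangle n. f k l)"
    by (rule sum.reindex_bij_witness[of _ "\<lambda>(k,l). (k+l,l)" "\<lambda>(k,l). (k-l,l)"])
       (auto simp: triangle_def)
  finally show ?thesis .
qed

section \<open>Standing assumptions, the mass bound and bounds on the coagulation rates\<close>

locale coagulation =
  fixes a :: "nat \<Rightarrow> nat \<Rightarrow> real" and r s cin :: "nat \<Rightarrow> real"
    and A R \<alpha> \<beta> \<gamma> :: real
  assumes A_pos: "A > 0"
    and alpha_beta: "0 \<le> \<alpha>" "\<alpha> \<le> \<beta>" "\<beta> \<le> 1"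
    and a_sym: "\<And>k l. k \<ge> 1 \<Longrightarrow> l \<ge> 1 \<Longrightarrow> a k l = a l k"
    and a_nonneg: "\<And>k l. k \<ge> 1 \<Longrightarrow> l \<ge> 1 \<Longrightarrow> 0 \<le> a k l"
    and a_bound: "\<And>k l. k \<ge> 1 \<Longrightarrow> l \<ge> 1 \<Longrightarrow>
        a k l \<le> A * (real k powr \<alpha> * real l powr \<beta> + real k powr \<beta> * real l powr \<alpha>)"
    and R_pos: "R > 0"
    and gamma: "\<gamma> > 0" "\<gamma> > \<alpha> + \<beta> - 1"
    and r_bound: "\<And>k. k \<ge> 1 \<Longrightarrow> r k \<ge> R * real k powr \<gamma>"
    and s_nonneg: "\<And>k. k \<ge> 1 \<Longrightarrow> s k \<ge> 0"
    and s_summable: "\<And>\<mu>. \<mu> \<ge> 0 \<Longrightarrow> (\<lambda>k. real k powr \<mu> * s k) summable_on {1..}"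
    and cin: "in_ell1 1 cin"
begin

definition S where "S \<mu> = (\<Sum>\<^sub>\<infinity>k\<in>{1..}. real k powr \<mu> * s k)"

text \<open>The mass \<open>m\<close> satisfies m' \<le> S 1 - R m, so the larger of its initial
  value and the equilibrium value S 1 / R bounds it for all times.\<close>

definition M where "M = max (\<Sum>\<^sub>\<infinity>k\<in>{1..}. real k * cin k) (S 1 / R)"

lemma S_nonneg: "0 \<le> S \<mu>"
  unfolding S_def using s_nonneg by (intro infsum_nonneg) auto

lemma M_nonneg: "0 \<le> M"
  using S_nonneg[of 1] R_pos by (simp add: M_def le_max_iff_disj)

lemma source_moment_le:
  assumes "\<mu> \<ge> 0"
  shows "(\<Sum>k=1..n. real k powr \<mu> * s k) \<le> S \<mu>"
  unfolding S_def using s_summable[OF assms] s_nonneg by (intro finite_sum_le_infsum) auto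

lemma source_le:
  assumes "\<mu> \<ge> 0" "k \<ge> 1"
  shows "real k powr \<mu> * s k \<le> S \<mu>"
proof -
  have "(\<Sum>k\<in>{k}. real k powr \<mu> * s k) \<le> S \<mu>"
    unfolding S_def using s_summable[OF assms(1)] s_nonneg assms
    by (intro finite_sum_le_infsum) auto
  then show ?thesis by simp
qed

lemma cin_nonneg: "k \<ge> 1 \<Longrightarrow> 0 \<le> cin k"
  using cin by (simp add: in_ell1_def)

lemma initial_mass_le: "(\<Sum>k=1..n. real k * cin k) \<le> M"
proof -
  have "(\<lambda>k. real k powr 1 * \<bar>cin k\<bar>) summable_on {1..}"
    using cin by (simp add: in_ell1_def wsummable_def)
  then have "(\<lambda>k. real k * cin k) summable_on {1..}"
    by (subst summable_on_cong[of _ _ "\<lambda>k. real k powr 1 * \<bar>cin k\<bar>"]) (auto simp: cin_nonneg)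
  then have "(\<Sum>k=1..n. real k * cin k) \<le> (\<Sum>\<^sub>\<infinity>k\<in>{1..}. real k * cin k)"
    using cin_nonneg by (intro finite_sum_le_infsum) auto
  then show ?thesis by (simp add: M_def)
qed

lemma r_ge: "k \<ge> 1 \<Longrightarrow> R \<le> r k"
proof -
  assume k: "k \<ge> 1"
  then have "1 \<le> real k powr \<gamma>" using gamma by (intro ge_one_powr_ge_zero) auto
  then have "R * 1 \<le> R * real k powr \<gamma>" using R_pos by (intro mult_left_mono) auto
  then show "R \<le> r k" using r_bound[OF k] by simp
qed

lemma r_pos: "k \<ge> 1 \<Longrightarrow> 0 < r k"
  using r_ge R_pos by force

text \<open>Both exponents are at most 1, so the rate is dominated by the product of the sizes; loss
  rates are then controlled by the mass alone.\<close>

lemma a_le: "k \<ge> 1 \<Longrightarrow> l \<ge> 1 \<Longrightarrow> a k l \<le> 2 * A * real k * real l"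
proof -
  assume k: "k \<ge> 1" and l: "l \<ge> 1"
  have *: "real i powr e \<le> real i" if "i \<ge> 1" "e \<le> 1" for i e
    using powr_mono[of e 1 "real i"] that by simp
  have "real k powr \<alpha> * real l powr \<beta> + real k powr \<beta> * real l powr \<alpha> \<le> real k * real l + real k * real l"
    using * k l alpha_beta by (intro add_mono mult_mono) auto
  then have "A * (real k powr \<alpha> * real l powr \<beta> + real k powr \<beta> * real l powr \<alpha>) \<le> A * (2 * (real k * real l))"
    using A_pos by (intro mult_left_mono) auto
  then show "a k l \<le> 2 * A * real k * real l" using a_bound[OF k l] by simp
qed

text \<open>Both powers of the smaller size are transferred to the larger one. This keeps the
  exponent \<alpha> + \<beta>, which is what \<gamma> has to compete with.\<close>

lemma a_le_ordered:
  assumes "1 \<le> l" "l \<le> k"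
  shows "a k l \<le> 2 * A * real k powr (\<alpha> + \<beta>)"
proof -
  have "real k powr \<alpha> * real l powr \<beta> + real k powr \<beta> * real l powr \<alpha>
      \<le> real k powr \<alpha> * real k powr \<beta> + real k powr \<beta> * real k powr \<alpha>"
    using assms alpha_beta by (intro add_mono mult_left_mono powr_mono2) auto
  also have "\<dots> = 2 * real k powr (\<alpha> + \<beta>)" by (simp add: powr_add)
  finally have "A * (real k powr \<alpha> * real l powr \<beta> + real k powr \<beta> * real l powr \<alpha>)
      \<le> A * (2 * real k powr (\<alpha> + \<beta>))"
    using A_pos by (intro mult_left_mono) auto
  then show ?thesis using a_bound[of k l] assms by simp
qed

text \<open>Right-hand side of the truncated system. The loss sum stops at \<open>n - k\<close>, so
  gain and loss run over the same pairs and truncation preserves mass in coagulation.\<close>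

definition F where
  "F n x k = (if 1 \<le> k \<and> k \<le> n then
      (1/2) * (\<Sum>l\<in>{1..<k}. a (k - l) l * x (k - l) * x l) - x k * (\<Sum>l=1..n-k. a k l * x l)
      + s k - r k * x k else 0)"

text \<open>Testing against a weight turns gain into a diagonal sum and loss into a row sum over the
  triangle. For the weight \<open>w k = k\<close> the bracket vanishes, which is conservation of
  mass.\<close>

lemma F_weak_form:
  "(\<Sum>k=1..n. w k * F n x k) =
     (1/2) * (\<Sum>(k,l)\<in>triangle n. a k l * x k * x l * (w (k + l) - w k - w l))
     + (\<Sum>k=1..n. w k * s k) - (\<Sum>k=1..n. w k * (r k * x k))"
proof -
  let ?f = "\<lambda>k l. a k l * x k * x l"
  have "(\<Sum>k=1..n. w k * F n x k) = (\<Sum>k=1..n. (1/2) * (\<Sum>l\<in>{1..<k}. w (k - l + l) * ?f (k - l) l)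
      - (\<Sum>l=1..n-k. w k * ?f k l) + w k * s k - w k * (r k * x k))"
    by (rule sum.cong) (auto simp: F_def sum_distrib_left algebra_simps intro!: sum.cong)
  also have "\<dots> = (1/2) * (\<Sum>k=1..n. \<Sum>l\<in>{1..<k}. w (k - l + l) * ?f (k - l) l)
      - (\<Sum>k=1..n. \<Sum>l=1..n-k. w k * ?f k l)
     + (\<Sum>k=1..n. w k * s k) - (\<Sum>k=1..n. w k * (r k * x k))"
    by (simp only: sum.distrib sum_subtractf sum_distrib_left[symmetric])
  also have "(\<Sum>k=1..n. \<Sum>l\<in>{1..<k}. w (k - l + l) * ?f (k - l) l) = (\<Sum>(k,l)\<in>triangle n. w (k + l) * ?f k l)"
    by (rule sum_triangle_diagonals)
  also have "(\<Sum>k=1..n. \<Sum>l=1..n-k. w k * ?f k l) = (\<Sum>(k,l)\<in>triangle n. w k * ?f k l)"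
    by (rule sum_triangle_rows)
  \<comment> \<open>Swapping the pair and using the symmetry of \<open>a\<close> replaces
    \<open>w k\<close> by the average of \<open>w k\<close> and \<open>w l\<close>.\<close>
  also have "(\<Sum>(k,l)\<in>triangle n. w k * ?f k l) = (1/2) * ((\<Sum>(k,l)\<in>triangle n. w k * ?f k l) + (\<Sum>(k,l)\<in>triangle n. w l * ?f k l))"
  proof -
    have "(\<Sum>(k,l)\<in>triangle n. w k * ?f k l) = (\<Sum>(k,l)\<in>triangle n. w l * ?f l k)"
      by (rule sum_triangle_swap)
    also have "\<dots> = (\<Sum>(k,l)\<in>triangle n. w l * ?f k l)"
      using a_sym by (intro sum.cong) (auto simp: triangle_def)
    finally show ?thesis by simp
  qed
  also have "(1/2) * (\<Sum>(k,l)\<in>triangle n. w (k + l) * ?f k l)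
      - (1/2) * ((\<Sum>(k,l)\<in>triangle n. w k * ?f k l) + (\<Sum>(k,l)\<in>triangle n. w l * ?f k l))
    = (1/2) * (\<Sum>(k,l)\<in>triangle n. ?f k l * (w (k + l) - w k - w l))"
    unfolding right_diff_distrib[symmetric]
    by (simp add: sum_subtractf[symmetric] sum.distrib[symmetric] case_prod_unfold algebra_simps)
  finally show ?thesis .
qed

text \<open>For l \<le> k the rate contributes k to the power \<alpha> + \<beta> and the power
  difference contributes k to the power \<mu> - 1 times l. The second summand on the right is
  nonnegative and makes the bound symmetric, so it holds for either ordering.\<close>

lemma gain_moment_bound:
  assumes "1 \<le> \<mu>" "1 \<le> k" "1 \<le> l"
  shows "a k l * ((real (k + l)) powr \<mu> - real k powr \<mu> - real l powr \<mu>)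
     \<le> 2 * A * \<mu> * 2 powr \<mu> * (real k powr (\<mu> - 1 + \<alpha> + \<beta>) * real l + real l powr (\<mu> - 1 + \<alpha> + \<beta>) * real k)"
proof -
  let ?D = "\<mu> * 2 powr \<mu>" and ?q = "\<mu> - 1 + \<alpha> + \<beta>"
  have *: "a k l * ((real (k + l)) powr \<mu> - real k powr \<mu> - real l powr \<mu>)
     \<le> 2 * A * ?D * (real k powr ?q * real l)" if "1 \<le> l" "l \<le> k" for k l
  proof -
    have "a k l * ((real (k + l)) powr \<mu> - real k powr \<mu> - real l powr \<mu>)
       \<le> a k l * (?D * (real k powr (\<mu> - 1) * real l))"
      using powr_add_diff_le[of "real l" "real k" \<mu>] that assms a_nonneg[of k l]
      by (intro mult_left_mono) auto
    also have "\<dots> \<le> (2 * A * real k powr (\<alpha> + \<beta>)) * (?D * (real k powr (\<mu> - 1) * real l))"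
      using a_le_ordered[OF that] assms by (intro mult_right_mono) auto
    also have "\<dots> = 2 * A * ?D * ((real k powr (\<alpha> + \<beta>) * real k powr (\<mu> - 1)) * real l)"
      by (simp add: algebra_simps)
    also have "real k powr (\<alpha> + \<beta>) * real k powr (\<mu> - 1) = real k powr ?q"
      by (simp flip: powr_add add: algebra_simps)
    finally show ?thesis .
  qed
  have pos: "0 \<le> 2 * A * ?D * (real i powr ?q * real j)" for i j
    using A_pos assms by simp
  have split: "2 * A * \<mu> * 2 powr \<mu> * (real k powr ?q * real l + real l powr ?q * real k)
      = 2 * A * ?D * (real k powr ?q * real l) + 2 * A * ?D * (real l powr ?q * real k)"
    by (simp add: algebra_simps)
  show ?thesis
  proof (cases "l \<le> k")
    case True
    then show ?thesis unfolding split using *[of l k] pos[of l k] assms by linarith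
  next
    case False
    then have "a k l * ((real (k + l)) powr \<mu> - real k powr \<mu> - real l powr \<mu>) \<le> 2 * A * ?D * (real l powr ?q * real k)"
      using *[of k l] assms a_sym[of k l] by (simp add: add.commute diff_diff_eq)
    then show ?thesis unfolding split using pos[of k l] by linarith
  qed
qed

text \<open>The gain is a multiple of the mass times the moment of order q = \<mu> - 1 + \<alpha> +
  \<beta>, and q < \<mu> + \<gamma> by the assumption on \<gamma>. Interpolation lets half of the
  removal term absorb it; the other half remains. \<open>C\<close> is chosen before \<open>n\<close>
  and \<open>x\<close>, so the estimate is uniform in the truncation.\<close>

lemma F_moment_bound:
  assumes \<mu>: "1 \<le> \<mu>"
  shows "\<exists>C\<ge>0. \<forall>n x. (\<forall>k. 0 \<le> x k) \<longrightarrow> (\<Sum>k=1..n. real k * x k) \<le> M \<longrightarrow>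
     (\<Sum>k=1..n. real k powr \<mu> * F n x k) \<le> C - (R/2) * (\<Sum>k=1..n. real k powr (\<mu> + \<gamma>) * x k)"
proof -
  define D where "D = 2 * A * \<mu> * 2 powr \<mu>"
  define q where "q = \<mu> - 1 + \<alpha> + \<beta>"
  have D: "0 \<le> D" using A_pos \<mu> by (simp add: D_def)
  \<comment> \<open>Chosen so that D M \<epsilon> \<le> R / 2; the summand 1 covers the case D M =
    0.\<close>
  define \<epsilon> where "\<epsilon> = R / (2 * (D * M + 1))"
  have DM: "0 \<le> D * M" using D M_nonneg by simp
  have \<epsilon>: "0 < \<epsilon>" using R_pos DM by (auto simp: \<epsilon>_def intro!: divide_pos_pos)
  have "D * M * \<epsilon> \<le> (D * M + 1) * \<epsilon>" using \<epsilon> by simp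
  also have "\<dots> = R / 2"
  proof -
    have "d * (R / (2 * d)) = R / 2" if "0 < d" for d using that by simp
    from this[of "D * M + 1"] show ?thesis using DM by (simp add: \<epsilon>_def)
  qed
  finally have DMe: "D * M * \<epsilon> \<le> R / 2" .
  obtain K where K: "0 \<le> K" "\<And>k. k \<ge> 1 \<Longrightarrow> real k powr q \<le> \<epsilon> * real k powr (\<mu> + \<gamma>) + K * real k"
    using powr_interpolation[of q "\<mu> + \<gamma>" \<epsilon>] \<epsilon> \<mu> alpha_beta gamma by (auto simp: q_def)
  define C where "C = D * M * (K * M) + S \<mu>"
  have "(\<Sum>k=1..n. real k powr \<mu> * F n x k) \<le> C - (R/2) * (\<Sum>k=1..n. real k powr (\<mu> + \<gamma>) * x k)"
    if x: "\<And>k. 0 \<le> x k" and mass: "(\<Sum>k=1..n. real k * x k) \<le> M" for n x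
  proof -
    let ?m = "\<lambda>p. \<Sum>k=1..n. real k powr p * x k"
    have "(\<Sum>(k,l)\<in>triangle n. a k l * x k * x l * (real (k + l) powr \<mu> - real k powr \<mu> - real l powr \<mu>))
      \<le> (\<Sum>(k,l)\<in>triangle n. D * ((real k powr q * x k) * (real l * x l) + (real l powr q * x l) * (real k * x k)))"
    proof (rule sum_mono, clarify)
      fix k l assume "(k, l) \<in> triangle n"
      then have kl: "1 \<le> k" "1 \<le> l" by (auto simp: triangle_def)
      have "(x k * x l) * (a k l * (real (k + l) powr \<mu> - real k powr \<mu> - real l powr \<mu>))
        \<le> (x k * x l) * (D * (real k powr q * real l + real l powr q * real k))"
        using gain_moment_bound[OF \<mu> kl] x by (intro mult_left_mono) (auto simp: D_def q_def)
      then show "a k l * x k * x l * (real (k + l) powr \<mu> - real k powr \<mu> - real l powr \<mu>)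
        \<le> D * ((real k powr q * x k) * (real l * x l) + (real l powr q * x l) * (real k * x k))"
        by (simp add: algebra_simps)
    qed
    \<comment> \<open>Enlarging the triangle to the square lets the double sum factor into a moment
      times the mass.\<close>
    also have "\<dots> \<le> (\<Sum>(k,l)\<in>{1..n}\<times>{1..n}. D * ((real k powr q * x k) * (real l * x l) + (real l powr q * x l) * (real k * x k)))"
      using x D by (intro sum_mono2) (auto simp: triangle_def)
    also have "\<dots> = D * (?m q * (\<Sum>k=1..n. real k * x k) + (\<Sum>k=1..n. real k * x k) * ?m q)"
      by (simp only: sum.distrib sum.cartesian_product[symmetric]
          sum_distrib_left[symmetric] sum_distrib_right[symmetric]) (simp only: mult.commute)
    also have "\<dots> = 2 * D * (?m q * (\<Sum>k=1..n. real k * x k))" by simp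
    also have "\<dots> \<le> 2 * D * (?m q * M)"
      using D mass x by (intro mult_left_mono sum_nonneg) auto
    finally have 1: "(1/2) * (\<Sum>(k,l)\<in>triangle n. a k l * x k * x l * (real (k + l) powr \<mu> - real k powr \<mu> - real l powr \<mu>)) \<le> D * M * ?m q"
      by (simp add: algebra_simps)
    have "?m q \<le> (\<Sum>k=1..n. (\<epsilon> * real k powr (\<mu> + \<gamma>) + K * real k) * x k)"
      using K x by (intro sum_mono mult_right_mono) auto
    also have "\<dots> = \<epsilon> * ?m (\<mu> + \<gamma>) + K * (\<Sum>k=1..n. real k * x k)"
      by (simp add: sum.distrib sum_distrib_left algebra_simps)
    also have "\<dots> \<le> \<epsilon> * ?m (\<mu> + \<gamma>) + K * M"
      using K mass by (intro add_left_mono mult_left_mono) auto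
    finally have "D * M * ?m q \<le> D * M * (\<epsilon> * ?m (\<mu> + \<gamma>) + K * M)"
      using DM by (intro mult_left_mono) auto
    also have "\<dots> = (D * M * \<epsilon>) * ?m (\<mu> + \<gamma>) + D * M * (K * M)" by (simp add: algebra_simps)
    also have "\<dots> \<le> (R/2) * ?m (\<mu> + \<gamma>) + D * M * (K * M)"
      using DMe x by (intro add_right_mono mult_right_mono sum_nonneg) auto
    finally have 2: "D * M * ?m q \<le> (R/2) * ?m (\<mu> + \<gamma>) + D * M * (K * M)" .
    have "R * ?m (\<mu> + \<gamma>) \<le> (\<Sum>k=1..n. real k powr \<mu> * (r k * x k))"
      unfolding sum_distrib_left
    proof (rule sum_mono)
      fix k assume "k \<in> {1..n}"
      then have "real k powr \<mu> * (R * real k powr \<gamma> * x k) \<le> real k powr \<mu> * (r k * x k)"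
        using r_bound x by (intro mult_left_mono mult_right_mono) auto
      then show "R * (real k powr (\<mu> + \<gamma>) * x k) \<le> real k powr \<mu> * (r k * x k)"
        by (simp add: powr_add algebra_simps)
    qed
    moreover have "(\<Sum>k=1..n. real k powr \<mu> * s k) \<le> S \<mu>"
      using \<mu> by (intro source_moment_le) auto
    ultimately show ?thesis
      using 1 2 unfolding F_weak_form[where w = "\<lambda>k. real k powr \<mu>"] C_def by argo
  qed
  moreover have "0 \<le> C" using DM K M_nonneg S_nonneg by (simp add: C_def)
  ultimately show ?thesis by blast
qed

subsection \<open>The Euler scheme\<close>

definition mom where "mom n p x = (\<Sum>k=1..n. real k powr p * x k)" for x :: "nat \<Rightarrow> real"

lemma mom_nonneg: "(\<And>k. 0 \<le> x k) \<Longrightarrow> 0 \<le> mom n p x"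
  unfolding mom_def by (intro sum_nonneg) auto

lemma mom_mono: "(\<And>k. 0 \<le> x k) \<Longrightarrow> p \<le> q \<Longrightarrow> mom n p x \<le> mom n q x"
  unfolding mom_def by (intro sum_mono mult_right_mono powr_mono) auto

lemma mom_1: "mom n 1 x = (\<Sum>k=1..n. real k * x k)"
  unfolding mom_def by (intro sum.cong) auto

text \<open>The denominator exceeds \<open>n\<close>, which forces the step to 0; \<open>R\<close>,
  which keeps the mass bound; and the total loss rate of every size up to \<open>n\<close>, which
  keeps nonnegativity.\<close>

definition h where "h n = 1 / (1 + real n + R + 2 * A * real n * M + (\<Sum>k=1..n. r k))"

lemma sum_r_nonneg: "0 \<le> (\<Sum>k=1..n. r k)"
  using r_pos by (intro sum_nonneg) (auto simp: less_imp_le)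

lemma step_AM_nonneg: "0 \<le> 2 * A * real n * M"
  using A_pos M_nonneg by simp

lemma h_pos: "0 < h n"
  unfolding h_def using sum_r_nonneg[of n] step_AM_nonneg[of n] R_pos by (intro divide_pos_pos) linarith+

lemma h_mult_le_1:
  assumes "0 \<le> x" "x \<le> 1 + real n + R + 2 * A * real n * M + (\<Sum>k=1..n. r k)"
  shows "h n * x \<le> 1"
proof -
  have "0 < 1 + real n + R + 2 * A * real n * M + (\<Sum>k=1..n. r k)"
    using sum_r_nonneg[of n] step_AM_nonneg[of n] R_pos by linarith
  then show ?thesis using assms by (simp add: h_def divide_le_eq)
qed

lemma h_R: "h n * R \<le> 1"
  using sum_r_nonneg[of n] step_AM_nonneg[of n] R_pos by (intro h_mult_le_1) linarith+

lemma h_le: "h n \<le> 1 / (1 + real n)"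
proof -
  have "h n * (1 + real n) \<le> 1"
    using sum_r_nonneg[of n] step_AM_nonneg[of n] R_pos by (intro h_mult_le_1) linarith+
  then show ?thesis by (simp add: field_simps)
qed

lemma h_tendsto: "h \<longlonglongrightarrow> 0"
proof (rule tendsto_sandwich[of "\<lambda>_. 0" h _ "\<lambda>n. 1 / (1 + real n)"])
  show "(\<lambda>n. 1 / (1 + real n)) \<longlonglongrightarrow> 0"
    using LIMSEQ_inverse_real_of_nat by (simp add: inverse_eq_divide add.commute)
qed (use h_le h_pos in \<open>auto intro!: always_eventually less_imp_le\<close>)

lemma h_loss:
  assumes "1 \<le> k" "k \<le> n"
  shows "h n * (2 * A * real k * M + r k) \<le> 1"
proof (rule h_mult_le_1)
  have "r k \<le> (\<Sum>k=1..n. r k)"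
    using assms r_pos by (intro member_le_sum) (auto simp: less_imp_le)
  moreover have "2 * A * real k * M \<le> 2 * A * real n * M"
    using A_pos M_nonneg assms by (intro mult_right_mono mult_left_mono) auto
  ultimately show "2 * A * real k * M + r k \<le> 1 + real n + R + 2 * A * real n * M + (\<Sum>k=1..n. r k)"
    using R_pos by linarith
qed (use step_AM_nonneg[of k] r_pos[of k] assms in linarith)

text \<open>\<open>u n j k\<close> is the concentration of size \<open>k\<close> in the system
  truncated at \<open>n\<close>, after \<open>j\<close> Euler steps, that is, at time
  \<open>h n * j\<close>.\<close>

primrec u :: "nat \<Rightarrow> nat \<Rightarrow> nat \<Rightarrow> real" where
  "u n 0 = (\<lambda>k. if 1 \<le> k \<and> k \<le> n then cin k else 0)"
| "u n (Suc j) = (\<lambda>k. u n j k + h n * F n (u n j) k)"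

lemma u_outside: "k = 0 \<or> n < k \<Longrightarrow> u n j k = 0"
  by (induction j) (auto simp: F_def)

lemma loss_sum_le:
  assumes "\<And>k. 0 \<le> x k" "(\<Sum>k=1..n. real k * x k) \<le> M" "1 \<le> k" "k \<le> n"
  shows "(\<Sum>l=1..n-k. a k l * x l) \<le> 2 * A * real k * M"
proof -
  have "(\<Sum>l=1..n-k. a k l * x l) \<le> (\<Sum>l=1..n-k. 2 * A * real k * (real l * x l))"
  proof (rule sum_mono)
    fix l assume "l \<in> {1..n-k}"
    then have "a k l * x l \<le> (2 * A * real k * real l) * x l"
      using a_le[of k l] assms by (intro mult_right_mono) auto
    then show "a k l * x l \<le> 2 * A * real k * (real l * x l)" by (simp add: mult.assoc)
  qed
  also have "\<dots> = 2 * A * real k * (\<Sum>l=1..n-k. real l * x l)"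
    by (simp add: sum_distrib_left)
  also have "\<dots> \<le> 2 * A * real k * (\<Sum>l=1..n. real l * x l)"
    using A_pos assms by (intro mult_left_mono sum_mono2) auto
  also have "\<dots> \<le> 2 * A * real k * M"
    using A_pos assms by (intro mult_left_mono) auto
  finally show ?thesis .
qed

text \<open>In the weak form with weight \<open>k\<close> coagulation cancels. Removal takes at
  least \<open>R\<close> times the mass, and the source satisfies S 1 \<le> R M by the choice of
  \<open>M\<close>.\<close>

lemma F_mass_bound:
  assumes "\<And>k. 0 \<le> x k"
  shows "(\<Sum>k=1..n. real k * F n x k) \<le> R * (M - (\<Sum>k=1..n. real k * x k))"
proof -
  have "(\<Sum>k=1..n. real k * F n x k) = (\<Sum>k=1..n. real k * s k) - (\<Sum>k=1..n. real k * (r k * x k))"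
    unfolding F_weak_form[where w = real] by (simp add: case_prod_unfold)
  moreover have "(\<Sum>k=1..n. real k * s k) \<le> S 1"
    using source_moment_le[of 1 n] by simp
  moreover have "S 1 \<le> R * M"
    using R_pos by (simp add: M_def max_def field_simps)
  moreover have "R * (\<Sum>k=1..n. real k * x k) \<le> (\<Sum>k=1..n. real k * (r k * x k))"
    unfolding sum_distrib_left
  proof (rule sum_mono)
    fix k assume "k \<in> {1..n}"
    then have "real k * (R * x k) \<le> real k * (r k * x k)"
      using r_ge assms by (intro mult_left_mono mult_right_mono) auto
    then show "R * (real k * x k) \<le> real k * (r k * x k)" by (simp add: algebra_simps)
  qed
  ultimately show ?thesis by (simp add: algebra_simps)
qed

lemma sum_u_Suc:
  "(\<Sum>k=1..n. w k * u n (Suc j) k) = (\<Sum>k=1..n. w k * u n j k) + h n * (\<Sum>k=1..n. w k * F n (u n j) k)"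
  by (simp add: sum_distrib_left sum.distrib[symmetric] algebra_simps)

text \<open>One joint induction: the mass bound limits the loss rate, so that one step cannot make a
  concentration negative, while the mass estimate itself requires nonnegativity. The new mass is at
  most a convex combination of the old mass and \<open>M\<close>, because \<open>h n * R\<close>
  \<le> 1.\<close>

lemma u_nonneg_mass: "(\<forall>k. 0 \<le> u n j k) \<and> (\<Sum>k=1..n. real k * u n j k) \<le> M"
proof (induction j)
  case 0
  have "(\<Sum>k=1..n. real k * u n 0 k) = (\<Sum>k=1..n. real k * cin k)"
    by (intro sum.cong) auto
  then show ?case using initial_mass_le[of n] cin_nonneg by auto
next
  case (Suc j)
  let ?x = "u n j"
  have x: "\<And>k. 0 \<le> ?x k" and mass: "(\<Sum>k=1..n. real k * ?x k) \<le> M" using Suc by auto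
  have "0 \<le> u n (Suc j) k" for k
  proof (cases "1 \<le> k \<and> k \<le> n")
    case True
    let ?L = "\<Sum>l=1..n-k. a k l * ?x l"
    have "0 \<le> (\<Sum>l\<in>{1..<k}. a (k - l) l * ?x (k - l) * ?x l)"
      using a_nonneg x by (intro sum_nonneg mult_nonneg_nonneg) auto
    then have "F n ?x k \<ge> - (?x k * (?L + r k))"
      using True s_nonneg[of k] by (simp add: F_def algebra_simps)
    then have F: "h n * F n ?x k \<ge> h n * - (?x k * (?L + r k))"
      using h_pos[of n] by (intro mult_left_mono) auto
    have "h n * (?L + r k) \<le> h n * (2 * A * real k * M + r k)"
      using loss_sum_le[OF x mass, of k] True h_pos[of n] by (intro mult_left_mono) auto
    then have "?x k * (h n * (?L + r k)) \<le> ?x k * 1"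
      using h_loss[of k n] True x by (intro mult_left_mono) auto
    then show ?thesis using F by (simp add: algebra_simps)
  next
    case False
    then have "k = 0 \<or> n < k" by auto
    then show ?thesis using u_outside by (metis order_refl)
  qed
  moreover have "(\<Sum>k=1..n. real k * u n (Suc j) k) \<le> M"
  proof -
    let ?m = "\<Sum>k=1..n. real k * ?x k"
    have "(\<Sum>k=1..n. real k * u n (Suc j) k) \<le> ?m + h n * (R * (M - ?m))"
      unfolding sum_u_Suc using F_mass_bound[OF x] h_pos[of n] by simp
    moreover have "(h n * R) * (M - ?m) \<le> 1 * (M - ?m)"
      using h_R mass by (intro mult_right_mono) auto
    ultimately show ?thesis by simp
  qed
  ultimately show ?case by blast
qed

lemma u_nonneg: "0 \<le> u n j k"
  using u_nonneg_mass by blast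

lemma u_mass: "(\<Sum>k=1..n. real k * u n j k) \<le> M"
  using u_nonneg_mass by blast

lemma u_le_M: "u n j k \<le> M"
proof (cases "1 \<le> k \<and> k \<le> n")
  case True
  have "1 * u n j k \<le> real k * u n j k"
    using True u_nonneg by (intro mult_right_mono) auto
  also have "\<dots> \<le> (\<Sum>k=1..n. real k * u n j k)"
    using True u_nonneg by (intro member_le_sum) auto
  finally show ?thesis using u_mass[of n j] by simp
next
  case False
  then show ?thesis using u_outside[of k n j] M_nonneg by force
qed

subsection \<open>Instantaneous moment bounds\<close>

lemma mom_step:
  assumes \<mu>: "1 \<le> \<mu>"
  shows "\<exists>C\<ge>0. \<forall>n j. mom n \<mu> (u n (Suc j)) \<le> mom n \<mu> (u n j) + h n * (C - (R/2) * mom n (\<mu> + \<gamma>) (u n j))"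
proof -
  obtain C where C: "0 \<le> C" "\<And>n x. \<lbrakk>\<And>k. 0 \<le> x k; (\<Sum>k=1..n. real k * x k) \<le> M\<rbrakk> \<Longrightarrow>
     (\<Sum>k=1..n. real k powr \<mu> * F n x k) \<le> C - (R/2) * (\<Sum>k=1..n. real k powr (\<mu> + \<gamma>) * x k)"
    using F_moment_bound[OF \<mu>] by blast
  have "mom n \<mu> (u n (Suc j)) \<le> mom n \<mu> (u n j) + h n * (C - (R/2) * mom n (\<mu> + \<gamma>) (u n j))" for n j
    unfolding mom_def sum_u_Suc
    using C(2)[of "u n j" n, OF u_nonneg u_mass] h_pos[of n] by simp
  then show ?thesis using C(1) by blast
qed

text \<open>Since sizes are at least 1, the moment of order \<mu> + \<gamma> dominates that of order
  \<mu>. With C \<le> (R/2) B, one step changes the moment by at most h R (B - m) / 2, which cannot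
  carry it past \<open>B\<close>.\<close>

lemma mom_propagate:
  assumes step: "\<And>j. mom n \<mu> (u n (Suc j)) \<le> mom n \<mu> (u n j) + h n * (C - (R/2) * mom n (\<mu> + \<gamma>) (u n j))"
    and B: "2 * C / R \<le> B" and init: "mom n \<mu> (u n i) \<le> B" and "i \<le> j"
  shows "mom n \<mu> (u n j) \<le> B"
  using \<open>i \<le> j\<close>
proof (induction j rule: dec_induct)
  case base
  then show ?case by (rule init)
next
  case (step j)
  let ?m = "mom n \<mu> (u n j)"
  have "(R/2) * ?m \<le> (R/2) * mom n (\<mu> + \<gamma>) (u n j)"
    using gamma R_pos u_nonneg by (intro mult_left_mono mom_mono) auto
  moreover have "C \<le> (R/2) * B" using B R_pos by (simp add: field_simps)
  ultimately have "h n * (C - (R/2) * mom n (\<mu> + \<gamma>) (u n j)) \<le> h n * ((R/2) * (B - ?m))"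
    using h_pos[of n] by (intro mult_left_mono) (auto simp: algebra_simps)
  also have "\<dots> = (h n * R) * ((B - ?m) / 2)" by simp
  also have "\<dots> \<le> 1 * ((B - ?m) / 2)"
    using h_R[of n] step.IH by (intro mult_right_mono) auto
  finally show ?case using assms(1)[of j] step.IH by argo
qed

text \<open>Induction gaining \<gamma> orders per step. If the moment of order \<mu> + \<gamma>
  stayed above \<open>K\<close> on a time window before \<open>j\<close>, the moment of order \<mu>
  would decrease at rate \<kappa> and become negative. So it lies below \<open>K\<close> at some
  earlier step, and \<open>mom_propagate\<close> carries the bound forward to
  \<open>j\<close>.\<close>

lemma mom_bound_aux:
  "0 < t0 \<Longrightarrow> \<exists>B\<ge>0. \<exists>N. \<forall>n\<ge>N. \<forall>j. t0 \<le> h n * real j \<longrightarrow> mom n (1 + real i * \<gamma>) (u n j) \<le> B"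
proof (induction i arbitrary: t0)
  case 0
  then show ?case using u_mass M_nonneg by (auto simp: mom_1)
next
  case (Suc i)
  let ?\<mu> = "1 + real i * \<gamma>"
  have \<mu>': "1 + real (Suc i) * \<gamma> = ?\<mu> + \<gamma>" by (simp add: algebra_simps)
  have \<mu>1: "1 \<le> ?\<mu>" and \<mu>2: "1 \<le> ?\<mu> + \<gamma>" using gamma by auto
  obtain C where C: "0 \<le> C" "\<And>n j. mom n ?\<mu> (u n (Suc j)) \<le> mom n ?\<mu> (u n j) + h n * (C - (R/2) * mom n (?\<mu> + \<gamma>) (u n j))"
    using mom_step[OF \<mu>1] by blast
  obtain C' where C': "0 \<le> C'" "\<And>n j. mom n (?\<mu> + \<gamma>) (u n (Suc j)) \<le> mom n (?\<mu> + \<gamma>) (u n j)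
      + h n * (C' - (R/2) * mom n (?\<mu> + \<gamma> + \<gamma>) (u n j))"
    using mom_step[OF \<mu>2] by blast
  obtain B N where B: "0 \<le> B" "\<And>n j. N \<le> n \<Longrightarrow> t0 / 2 \<le> h n * real j \<Longrightarrow> mom n ?\<mu> (u n j) \<le> B"
    using Suc.IH[of "t0/2"] Suc.prems by auto
  \<comment> \<open>With such a step, rounding t0 / 2 up to the grid still leaves a window of length
    at least t0 / 4 before t0.\<close>
  have "eventually (\<lambda>n. h n < t0 / 4) sequentially"
    using h_tendsto Suc.prems by (intro order_tendstoD) auto
  then obtain N1 where N1: "\<And>n. N1 \<le> n \<Longrightarrow> h n < t0 / 4"
    by (auto simp: eventually_sequentially)
  \<comment> \<open>A decrease at rate \<kappa> over time t0 / 4 amounts to B + 1, more than the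
    lower moment can lose. \<open>K\<close> below is the level of the higher moment that forces this
    rate.\<close>
  define \<kappa> where "\<kappa> = 4 * (B + 1) / t0"
  have \<kappa>: "0 \<le> \<kappa>" "t0 / 4 * \<kappa> = B + 1" using Suc.prems B(1) by (auto simp: \<kappa>_def)
  define K where "K = (2 / R) * (C + \<kappa>)"
  have cancel: "(R/2) * ((2/R) * x) = x" for x using R_pos by simp
  have RK: "C - (R/2) * K = - \<kappa>" unfolding K_def cancel by linarith
  define B' where "B' = max K (2 * C' / R)"
  have "mom n (?\<mu> + \<gamma>) (u n j) \<le> B'" if n: "max N N1 \<le> n" and j: "t0 \<le> h n * real j" for n j
  proof -
    define j0 where "j0 = nat \<lceil>t0 / (2 * h n)\<rceil>"
    have hp: "0 < h n" by (rule h_pos)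
    have pos: "0 \<le> t0 / (2 * h n)" using hp Suc.prems by simp
    have "t0 / (2 * h n) \<le> real j0" "real j0 \<le> t0 / (2 * h n) + 1"
      using pos unfolding j0_def by linarith+
    then have j0: "t0 / 2 \<le> h n * real j0" "h n * real j0 \<le> t0 / 2 + h n"
      using hp by (auto simp: field_simps)
    have hn: "h n < t0 / 4" using N1 n by auto
    have long: "t0 / 4 \<le> h n * real j - h n * real j0"
      using j0 j hn by linarith
    then have "h n * real j0 < h n * real j" using Suc.prems by linarith
    then have "j0 < j" using hp by simp
    have "\<exists>i\<ge>j0. i < j \<and> mom n (?\<mu> + \<gamma>) (u n i) \<le> K"
    proof (rule ccontr)
      assume "\<not> ?thesis"
      then have big: "\<And>i. j0 \<le> i \<Longrightarrow> i < j \<Longrightarrow> K < mom n (?\<mu> + \<gamma>) (u n i)" by force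
      have "m \<le> j \<longrightarrow> mom n ?\<mu> (u n m) \<le> mom n ?\<mu> (u n j0) - h n * (real m - real j0) * \<kappa>" if "j0 \<le> m" for m
        using that
      proof (induction m rule: dec_induct)
        case (step m)
        show ?case
        proof
          assume m: "Suc m \<le> j"
          have "(R/2) * K \<le> (R/2) * mom n (?\<mu> + \<gamma>) (u n m)"
            using big[of m] step m R_pos by (intro mult_left_mono) auto
          then have "h n * (C - (R/2) * mom n (?\<mu> + \<gamma>) (u n m)) \<le> h n * (- \<kappa>)"
            using hp RK by (intro mult_left_mono) auto
          then have "mom n ?\<mu> (u n (Suc m)) \<le> mom n ?\<mu> (u n m) - h n * \<kappa>"
            using C(2)[of n m] by simp
          moreover have "h n * (real (Suc m) - real j0) * \<kappa>
              = h n * (real m - real j0) * \<kappa> + h n * \<kappa>"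
            by (simp add: algebra_simps)
          ultimately show "mom n ?\<mu> (u n (Suc m)) \<le> mom n ?\<mu> (u n j0) - h n * (real (Suc m) - real j0) * \<kappa>"
            using step m by simp
        qed
      qed simp
      then have "mom n ?\<mu> (u n j) \<le> mom n ?\<mu> (u n j0) - h n * (real j - real j0) * \<kappa>"
        using \<open>j0 < j\<close> by simp
      moreover have "mom n ?\<mu> (u n j0) \<le> B" using B(2) n j0 by auto
      moreover have "t0 / 4 * \<kappa> \<le> h n * (real j - real j0) * \<kappa>"
        using long \<kappa>(1) by (intro mult_right_mono) (auto simp: right_diff_distrib)
      ultimately have "mom n ?\<mu> (u n j) < 0" using \<kappa>(2) by linarith
      then show False using mom_nonneg[of "u n j" n ?\<mu>] u_nonneg by force
    qed
    then obtain i where i: "i < j" "mom n (?\<mu> + \<gamma>) (u n i) \<le> K" by blast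
    show ?thesis
      using C'(2)[of n] i by (intro mom_propagate[of n "?\<mu> + \<gamma>" C' B' i j]) (auto simp: B'_def)
  qed
  moreover have "0 \<le> B'" using C'(1) R_pos by (simp add: B'_def le_max_iff_disj)
  ultimately show ?case unfolding \<mu>' by blast
qed

lemma mom_bound:
  assumes "0 < t0"
  shows "\<exists>B\<ge>0. \<exists>N. \<forall>n\<ge>N. \<forall>j. t0 \<le> h n * real j \<longrightarrow> mom n p (u n j) \<le> B"
proof -
  obtain i where "p < real i * \<gamma>" using reals_Archimedean3 gamma(1) by blast
  then have le: "mom n p (u n j) \<le> mom n (1 + real i * \<gamma>) (u n j)" for n j
    by (intro mom_mono u_nonneg) auto
  obtain B N where "0 \<le> B" "\<And>n j. N \<le> n \<Longrightarrow> t0 \<le> h n * real j \<Longrightarrow> mom n (1 + real i * \<gamma>) (u n j) \<le> B"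
    using mom_bound_aux[OF assms, of i] by blast
  then show ?thesis using le order_trans by blast
qed

subsection \<open>Passage to the limit\<close>

text \<open>Piecewise constant interpolation, using the last grid point up to \<open>t\<close>. For
  t < 0 the index is 0, so the values stay in [0, M] for every real \<open>t\<close>, as the
  compactness argument requires.\<close>

definition U where "U n k t = u n (nat \<lfloor>t / h n\<rfloor>) k"

lemma grid_bounds:
  assumes "0 \<le> t"
  shows "t - h n < h n * real (nat \<lfloor>t / h n\<rfloor>)" "h n * real (nat \<lfloor>t / h n\<rfloor>) \<le> t"
proof -
  have "0 \<le> t / h n" using assms h_pos[of n] by simp
  then have "t / h n - 1 < real (nat \<lfloor>t / h n\<rfloor>)" "real (nat \<lfloor>t / h n\<rfloor>) \<le> t / h n"
    by linarith+
  then show "t - h n < h n * real (nat \<lfloor>t / h n\<rfloor>)" "h n * real (nat \<lfloor>t / h n\<rfloor>) \<le> t"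
    using h_pos[of n] by (auto simp: field_simps)
qed

text \<open>Bounds |F| by inserting \<open>M\<close> for every concentration and for the mass. It
  depends on \<open>k\<close>, also through \<open>r k\<close>, but not on \<open>n\<close>.\<close>

definition Lip where
  "Lip k = (1/2) * (\<Sum>l\<in>{1..<k}. a (k - l) l * M * M) + M * (2 * A * real k * M) + s k + r k * M"

lemma Lip_nonneg: "1 \<le> k \<Longrightarrow> 0 \<le> Lip k"
  unfolding Lip_def using a_nonneg M_nonneg A_pos s_nonneg r_pos[of k]
  by (intro add_nonneg_nonneg mult_nonneg_nonneg sum_nonneg) auto

lemma F_le_Lip:
  assumes "1 \<le> k"
  shows "\<bar>F n (u n j) k\<bar> \<le> Lip k"
proof (cases "k \<le> n")
  case True
  let ?x = "u n j"
  have gain: "(\<Sum>l\<in>{1..<k}. a (k - l) l * ?x (k - l) * ?x l) \<le> (\<Sum>l\<in>{1..<k}. a (k - l) l * M * M)"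
    using a_nonneg u_nonneg u_le_M M_nonneg by (intro sum_mono mult_mono) auto
  have gain0: "0 \<le> (\<Sum>l\<in>{1..<k}. a (k - l) l * ?x (k - l) * ?x l)"
    using a_nonneg u_nonneg by (intro sum_nonneg mult_nonneg_nonneg) auto
  have loss: "?x k * (\<Sum>l=1..n-k. a k l * ?x l) \<le> M * (2 * A * real k * M)"
    using loss_sum_le[of ?x n k] u_nonneg u_mass assms True u_le_M M_nonneg A_pos a_nonneg
    by (intro mult_mono) (auto intro!: sum_nonneg)
  have loss0: "0 \<le> ?x k * (\<Sum>l=1..n-k. a k l * ?x l)"
    using u_nonneg a_nonneg assms by (auto intro!: sum_nonneg mult_nonneg_nonneg)
  have rem: "r k * ?x k \<le> r k * M" "0 \<le> r k * ?x k"
    using r_pos[OF assms] u_le_M u_nonneg by (auto intro!: mult_left_mono)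
  have "M * (2 * A * real k * M) \<ge> 0" "r k * M \<ge> 0" using rem loss loss0 by linarith+
  then show ?thesis
    using gain gain0 loss loss0 rem s_nonneg[OF assms] assms True
    unfolding F_def Lip_def by simp
qed (use Lip_nonneg[OF assms] in \<open>simp add: F_def\<close>)

lemma u_telescope:
  assumes "i \<le> j"
  shows "u n j k - u n i k = h n * (\<Sum>m\<in>{i..<j}. F n (u n m) k)"
proof -
  have "(\<Sum>m\<in>{i..<j}. h n * F n (u n m) k) = (\<Sum>m\<in>{i..<j}. u n (Suc m) k - u n m k)"
    by (intro sum.cong) auto
  then show ?thesis using sum_Suc_diff'[OF assms, of "\<lambda>m. u n m k"] by (simp add: sum_distrib_left)
qed

text \<open>A discrete mean value estimate around a reference slope \<open>G\<close>. It is used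
  with \<open>G = 0\<close> for Lipschitz bounds and with the limiting right-hand side for
  differentiability.\<close>

lemma u_increment:
  assumes "i \<le> j" "\<And>m. i \<le> m \<Longrightarrow> m < j \<Longrightarrow> \<bar>F n (u n m) k - G\<bar> \<le> e"
  shows "\<bar>u n j k - u n i k - (h n * real j - h n * real i) * G\<bar> \<le> (h n * real j - h n * real i) * e"
proof -
  have eq: "u n j k - u n i k - (h n * real j - h n * real i) * G = h n * (\<Sum>m\<in>{i..<j}. F n (u n m) k - G)"
    using assms(1) by (simp add: u_telescope sum_subtractf of_nat_diff algebra_simps)
  have "\<bar>u n j k - u n i k - (h n * real j - h n * real i) * G\<bar> \<le> h n * (\<Sum>m\<in>{i..<j}. \<bar>F n (u n m) k - G\<bar>)"
    unfolding eq using h_pos[of n] by (simp add: abs_mult sum_abs)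
  also have "\<dots> \<le> h n * (\<Sum>m\<in>{i..<j}. e)"
    using h_pos[of n] assms(2) by (intro mult_left_mono sum_mono) auto
  also have "\<dots> = (h n * real j - h n * real i) * e"
    using assms(1) by (simp add: of_nat_diff algebra_simps)
  finally show ?thesis .
qed

text \<open>The additional \<open>h n\<close> accounts for the jumps of the piecewise constant
  interpolation; it disappears in the limit.\<close>

lemma U_Lipschitz:
  assumes "1 \<le> k" "0 \<le> t" "0 \<le> t'"
  shows "\<bar>U n k t' - U n k t\<bar> \<le> Lip k * (\<bar>t' - t\<bar> + h n)"
proof -
  have *: "\<bar>U n k y - U n k x\<bar> \<le> Lip k * (\<bar>y - x\<bar> + h n)" if "0 \<le> x" "x \<le> y" for x y
  proof -
    let ?i = "nat \<lfloor>x / h n\<rfloor>" and ?j = "nat \<lfloor>y / h n\<rfloor>"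
    have "?i \<le> ?j" using that h_pos[of n] by (intro nat_mono floor_mono divide_right_mono) auto
    then have "\<bar>U n k y - U n k x\<bar> \<le> (h n * real ?j - h n * real ?i) * Lip k"
      unfolding U_def using u_increment[of ?i ?j n k 0 "Lip k"] F_le_Lip[OF assms(1)] by simp
    also have "\<dots> \<le> (\<bar>y - x\<bar> + h n) * Lip k"
      using grid_bounds[of x n] grid_bounds[of y n] that Lip_nonneg[OF assms(1)]
      by (intro mult_right_mono) auto
    finally show ?thesis by (simp add: mult.commute)
  qed
  show ?thesis
    using *[of t t'] *[of t' t] assms by (cases "t \<le> t'") (auto simp: abs_minus_commute)
qed

text \<open>The right-hand side with the loss sum cut at a fixed \<open>m\<close>. It involves
  finitely many coordinates, so coordinatewise convergence passes through it.\<close>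

definition P where
  "P m x k = (1/2) * (\<Sum>l\<in>{1..<k}. a (k - l) l * x (k - l) * x l) - x k * (\<Sum>l=1..m. a k l * x l)
      + s k - r k * x k"

text \<open>For l > m the size satisfies l \<le> l * l / (m + 1), so the second moment controls the
  omitted loss terms uniformly in \<open>n\<close>.\<close>

lemma F_tail_bound:
  assumes "mom n 2 (u n j) \<le> B" "1 \<le> k" "k + m \<le> n"
  shows "\<bar>F n (u n j) k - P m (u n j) k\<bar> \<le> M * (2 * A * real k * B) / real (m + 1)"
proof -
  let ?x = "u n j"
  have split: "(\<Sum>l=1..n-k. a k l * ?x l) = (\<Sum>l=1..m. a k l * ?x l) + (\<Sum>l=m+1..n-k. a k l * ?x l)"
    using assms sum.ub_add_nat[of 1 m "\<lambda>l. a k l * ?x l" "n - k - m"] by simp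
  have "(\<Sum>l=m+1..n-k. a k l * ?x l) \<le> (\<Sum>l=m+1..n-k. (2 * A * real k / real (m + 1)) * (real l powr 2 * ?x l))"
  proof (rule sum_mono)
    fix l assume l: "l \<in> {m+1..n-k}"
    have "real l * real (m + 1) \<le> real l * real l" using l by (intro mult_left_mono) auto
    then have "real l \<le> real l powr 2 / real (m + 1)"
      using l by (simp add: pos_le_divide_eq power2_eq_square powr_numeral)
    then have "2 * A * real k * real l * ?x l \<le> 2 * A * real k * (real l powr 2 / real (m + 1)) * ?x l"
      using A_pos u_nonneg by (intro mult_right_mono mult_left_mono) auto
    moreover have "a k l * ?x l \<le> 2 * A * real k * real l * ?x l"
      using a_le[of k l] l assms u_nonneg by (intro mult_right_mono) auto
    ultimately show "a k l * ?x l \<le> (2 * A * real k / real (m + 1)) * (real l powr 2 * ?x l)"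
      by simp
  qed
  also have "\<dots> = (2 * A * real k / real (m + 1)) * (\<Sum>l=m+1..n-k. real l powr 2 * ?x l)"
    by (simp add: sum_distrib_left)
  also have "\<dots> \<le> (2 * A * real k / real (m + 1)) * mom n 2 ?x"
    unfolding mom_def using A_pos u_nonneg by (intro mult_left_mono sum_mono2) auto
  also have "\<dots> \<le> (2 * A * real k / real (m + 1)) * B"
    using A_pos assms by (intro mult_left_mono) auto
  finally have tail: "(\<Sum>l=m+1..n-k. a k l * ?x l) \<le> (2 * A * real k / real (m + 1)) * B" .
  have eq: "F n ?x k - P m ?x k = - (?x k * (\<Sum>l=m+1..n-k. a k l * ?x l))"
    using assms unfolding F_def P_def split by (simp add: algebra_simps)
  have "\<bar>F n ?x k - P m ?x k\<bar> = ?x k * (\<Sum>l=m+1..n-k. a k l * ?x l)"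
  proof -
    have "0 \<le> ?x k * (\<Sum>l=m+1..n-k. a k l * ?x l)"
      using u_nonneg a_nonneg assms by (intro mult_nonneg_nonneg sum_nonneg) auto
    then show ?thesis by (simp only: eq abs_minus_cancel abs_of_nonneg)
  qed
  also have "\<dots> \<le> M * (\<Sum>l=m+1..n-k. a k l * ?x l)"
    using u_le_M a_nonneg u_nonneg assms by (intro mult_right_mono sum_nonneg) auto
  also have "\<dots> \<le> M * ((2 * A * real k / real (m + 1)) * B)"
    using tail M_nonneg by (intro mult_left_mono) auto
  finally show ?thesis by simp
qed

end

text \<open>\<open>Fl\<close> and \<open>c\<close> stand for the output of
  \<open>bounded_functions_cluster\<close>: one filter along which the interpolants converge for all
  sizes and all real times simultaneously.\<close>

locale coagulation_limit = coagulation +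
  fixes Fl :: "nat filter" and c :: "nat \<Rightarrow> real \<Rightarrow> real"
  assumes Fl_nontrivial: "Fl \<noteq> bot" and Fl_sequentially: "Fl \<le> sequentially"
    and U_tendsto: "\<And>k t. ((\<lambda>n. U n k t) \<longlongrightarrow> c k t) Fl"
begin

lemma eventually_Fl: "eventually Q sequentially \<Longrightarrow> eventually Q Fl"
  using Fl_sequentially by (simp add: filter_leD)

lemma h_tendsto_Fl: "(h \<longlongrightarrow> 0) Fl"
  using h_tendsto Fl_sequentially by (rule tendsto_mono[rotated])

lemma grid_tendsto: "0 \<le> t \<Longrightarrow> ((\<lambda>n. h n * real (nat \<lfloor>t / h n\<rfloor>)) \<longlongrightarrow> t) Fl"
proof (rule tendsto_sandwich[of "\<lambda>n. t - h n" _ _ "\<lambda>_. t"])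
  show "((\<lambda>n. t - h n) \<longlongrightarrow> t) Fl"
    using tendsto_diff[OF tendsto_const h_tendsto_Fl, of t] by simp
qed (use grid_bounds in \<open>auto intro!: always_eventually less_imp_le\<close>)

lemma c_nonneg: "0 \<le> c k t"
  by (rule tendsto_lowerbound[OF U_tendsto _ Fl_nontrivial]) (simp add: U_def u_nonneg)

lemma c_le_M: "c k t \<le> M"
  by (rule tendsto_upperbound[OF U_tendsto _ Fl_nontrivial]) (simp add: U_def u_le_M)

lemma c_initial: "1 \<le> k \<Longrightarrow> c k 0 = cin k"
proof -
  assume k: "1 \<le> k"
  have "eventually (\<lambda>n. U n k 0 = cin k) Fl"
    using eventually_Fl[OF eventually_ge_at_top[of k]] by eventually_elim (use k in \<open>simp add: U_def\<close>)
  then have "((\<lambda>n. U n k 0) \<longlongrightarrow> cin k) Fl" by (rule tendsto_eventually)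
  then show ?thesis using U_tendsto Fl_nontrivial tendsto_unique by blast
qed

text \<open>Fatou's argument: for fixed \<open>N\<close> the finite sum passes to the limit, and
  eventually n \<ge> N, so it is part of the truncated moment.\<close>

lemma moment_limit:
  assumes "eventually (\<lambda>n. mom n p (\<lambda>k. U n k t) \<le> B) Fl"
  shows "(\<Sum>k=1..N. real k powr p * c k t) \<le> B"
proof (rule tendsto_upperbound[OF _ _ Fl_nontrivial])
  show "((\<lambda>n. \<Sum>k=1..N. real k powr p * U n k t) \<longlongrightarrow> (\<Sum>k=1..N. real k powr p * c k t)) Fl"
    by (intro tendsto_intros U_tendsto)
  show "eventually (\<lambda>n. (\<Sum>k=1..N. real k powr p * U n k t) \<le> B) Fl"
    using assms eventually_Fl[OF eventually_ge_at_top[of N]]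
  proof eventually_elim
    case (elim n)
    have "(\<Sum>k=1..N. real k powr p * U n k t) \<le> mom n p (\<lambda>k. U n k t)"
      unfolding mom_def using elim by (intro sum_mono2) (auto simp: U_def u_nonneg)
    then show ?case using elim by simp
  qed
qed

lemma c_mass: "(\<Sum>k=1..N. real k powr 1 * c k t) \<le> M"
  by (rule moment_limit) (simp add: U_def mom_1 u_mass[simplified])

lemma c_moments:
  assumes "0 < t0"
  shows "\<exists>B\<ge>0. \<forall>t\<ge>t0. \<forall>N. (\<Sum>k=1..N. real k powr p * c k t) \<le> B"
proof -
  \<comment> \<open>Started at t0 / 2 because the grid point representing t \<ge> t0 is only known
    to exceed t - \<open>h n\<close>.\<close>
  obtain B N0 where B: "0 \<le> B" "\<And>n j. N0 \<le> n \<Longrightarrow> t0 / 2 \<le> h n * real j \<Longrightarrow> mom n p (u n j) \<le> B"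
    using mom_bound[of "t0/2" p] assms by auto
  have "(\<Sum>k=1..N. real k powr p * c k t) \<le> B" if t: "t0 \<le> t" for t N
  proof (rule moment_limit)
    have "eventually (\<lambda>n. h n < t0 / 2) Fl"
      using h_tendsto_Fl assms by (intro order_tendstoD) auto
    then show "eventually (\<lambda>n. mom n p (\<lambda>k. U n k t) \<le> B) Fl"
      using eventually_Fl[OF eventually_ge_at_top[of N0]]
    proof eventually_elim
      case (elim n)
      then show ?case
        unfolding U_def using B(2)[of n "nat \<lfloor>t / h n\<rfloor>"] grid_bounds(1)[of t n] t assms by simp
    qed
  qed
  then show ?thesis using B(1) by blast
qed

text \<open>The limit of \<open>u_increment\<close>. The condition on \<open>F\<close> concerns only
  grid times in (t1 - \<open>h n\<close>, t2], since rounding t1 down to the grid may move it by up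
  to one step.\<close>

lemma c_increment:
  assumes "0 \<le> t1" "t1 \<le> t2"
    and ev: "eventually (\<lambda>n. \<forall>j. t1 - h n < h n * real j \<longrightarrow> h n * real j \<le> t2 \<longrightarrow> \<bar>F n (u n j) k - G\<bar> \<le> e) Fl"
  shows "\<bar>c k t2 - c k t1 - (t2 - t1) * G\<bar> \<le> (t2 - t1) * e"
proof (rule tendsto_le[OF Fl_nontrivial])
  let ?g = "\<lambda>n t. h n * real (nat \<lfloor>t / h n\<rfloor>)"
  have g: "((\<lambda>n. ?g n t1) \<longlongrightarrow> t1) Fl" "((\<lambda>n. ?g n t2) \<longlongrightarrow> t2) Fl"
    using assms by (auto intro!: grid_tendsto)
  show "((\<lambda>n. \<bar>U n k t2 - U n k t1 - (?g n t2 - ?g n t1) * G\<bar>) \<longlongrightarrow> \<bar>c k t2 - c k t1 - (t2 - t1) * G\<bar>) Fl"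
    by (intro tendsto_intros U_tendsto g)
  show "((\<lambda>n. (?g n t2 - ?g n t1) * e) \<longlongrightarrow> (t2 - t1) * e) Fl"
    by (intro tendsto_intros g)
  show "eventually (\<lambda>n. \<bar>U n k t2 - U n k t1 - (?g n t2 - ?g n t1) * G\<bar> \<le> (?g n t2 - ?g n t1) * e) Fl"
    using ev
  proof eventually_elim
    case (elim n)
    let ?i = "nat \<lfloor>t1 / h n\<rfloor>" and ?j = "nat \<lfloor>t2 / h n\<rfloor>"
    have ij: "?i \<le> ?j" using assms h_pos[of n] by (intro nat_mono floor_mono divide_right_mono) auto
    have "\<bar>F n (u n m) k - G\<bar> \<le> e" if "?i \<le> m" "m < ?j" for m
    proof -
      have "h n * real ?i \<le> h n * real m" "h n * real m \<le> h n * real ?j"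
        using that h_pos[of n] by (auto intro!: mult_left_mono)
      then show ?thesis
        using elim grid_bounds(1)[of t1 n] grid_bounds(2)[of t2 n] assms by auto
    qed
    then show ?case unfolding U_def using u_increment[OF ij] by blast
  qed
qed

lemma c_Lipschitz:
  assumes "1 \<le> k" "0 \<le> t1" "t1 \<le> t2"
  shows "\<bar>c k t2 - c k t1\<bar> \<le> (t2 - t1) * Lip k"
  using c_increment[of t1 t2 k 0 "Lip k"] F_le_Lip[OF assms(1)] assms by simp

lemma c_continuous:
  assumes "1 \<le> k"
  shows "continuous_on {0..} (c k)"
proof (rule lipschitz_on_continuous_on[of "Lip k"], rule lipschitz_onI)
  fix x y :: real assume "x \<in> {0..}" "y \<in> {0..}"
  then show "dist (c k x) (c k y) \<le> Lip k * dist x y"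
    using c_Lipschitz[OF assms, of x y] c_Lipschitz[OF assms, of y x]
    by (cases "x \<le> y") (auto simp: dist_real_def abs_minus_commute mult.commute)
qed (rule Lip_nonneg[OF assms])

lemma moment_summable:
  assumes "0 < t"
  shows "(\<lambda>k. real k powr p * c k t) summable_on {1..}"
proof -
  obtain B where "\<And>N. (\<Sum>k=1..N. real k powr p * c k t) \<le> B"
    using c_moments[OF assms, of p] by auto
  then show ?thesis
    using c_nonneg by (intro summable_on_from_partial_sums) auto
qed

section \<open>Convergence of the right-hand side and the limit equation\<close>

lemma loss_summable:
  assumes "0 < t" "1 \<le> k"
  shows "(\<lambda>l. a k l * c l t) summable_on {1..}"
proof (rule summable_on_comparison_test)
  show "(\<lambda>l. 2 * A * real k * (real l powr 1 * c l t)) summable_on {1..}"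
    by (rule summable_on_cmult_right[OF moment_summable[OF assms(1)]])
  fix l :: nat assume l: "l \<in> {1..}"
  have "a k l * c l t \<le> (2 * A * real k * real l) * c l t"
    using a_le[of k l] l assms c_nonneg by (intro mult_right_mono) auto
  then show "a k l * c l t \<le> 2 * A * real k * (real l powr 1 * c l t)"
    using l by (simp add: mult_ac)
  show "0 \<le> a k l * c l t" using a_nonneg assms l c_nonneg by simp
qed

lemma P_tendsto_rhs:
  assumes "0 < t" "1 \<le> k"
  shows "(\<lambda>m. P m (\<lambda>i. c i t) k) \<longlonglongrightarrow> coag_rhs a s r (\<lambda>i. c i t) k"
  unfolding P_def coag_rhs_def
  by (intro tendsto_intros partial_sums_tendsto_infsum loss_summable assms)
     (use a_nonneg c_nonneg assms in auto)

text \<open>The Lipschitz bound, uniform in \<open>n\<close> up to \<open>h n\<close>, upgrades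
  pointwise convergence to convergence jointly in the truncation and in time near
  \<open>t\<close>.\<close>

lemma U_tendsto_joint:
  assumes "0 < t" "1 \<le> k"
  shows "((\<lambda>(n,t'). U n k t') \<longlongrightarrow> c k t) (Fl \<times>\<^sub>F nhds t)"
proof -
  let ?FF = "Fl \<times>\<^sub>F nhds t"
  have fst: "filterlim fst Fl ?FF" and snd: "filterlim snd (nhds t) ?FF"
    by (rule filterlim_fst filterlim_snd)+
  have "((\<lambda>x. Lip k * (\<bar>snd x - t\<bar> + h (fst x))) \<longlongrightarrow> Lip k * (\<bar>t - t\<bar> + 0)) ?FF"
    by (intro tendsto_intros snd filterlim_compose[OF h_tendsto_Fl fst])
  then have 1: "((\<lambda>x. Lip k * (\<bar>snd x - t\<bar> + h (fst x))) \<longlongrightarrow> 0) ?FF" by simp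
  have "eventually (\<lambda>t'. t' \<in> {0<..}) (nhds t)"
    using assms by (intro eventually_nhds_in_open) auto
  then have "eventually (\<lambda>x. 0 < snd x) ?FF"
    using snd unfolding filterlim_iff by auto
  then have "eventually (\<lambda>x. norm (U (fst x) k (snd x) - U (fst x) k t) \<le> Lip k * (\<bar>snd x - t\<bar> + h (fst x))) ?FF"
    by eventually_elim (use U_Lipschitz[OF assms(2)] assms in \<open>auto simp: less_imp_le\<close>)
  then have "((\<lambda>x. U (fst x) k (snd x) - U (fst x) k t) \<longlongrightarrow> 0) ?FF"
    by (rule Lim_null_comparison[OF _ 1])
  from tendsto_add[OF this filterlim_compose[OF U_tendsto fst, of k t]]
  show ?thesis by (simp add: case_prod_unfold)
qed

text \<open>Three errors of size \<epsilon> / 3. A fixed cut-off \<open>m\<close> makes both the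
  omitted loss terms of the scheme and the distance of \<open>P m\<close> to the limiting right-hand
  side small; for that \<open>m\<close>, the finite expression \<open>P m\<close> converges by
  \<open>U_tendsto_joint\<close>.\<close>

lemma F_tendsto_joint:
  assumes "0 < t" "1 \<le> k"
  shows "((\<lambda>(n,t'). F n (\<lambda>i. U n i t') k) \<longlongrightarrow> coag_rhs a s r (\<lambda>i. c i t) k) (Fl \<times>\<^sub>F nhds t)"
proof (rule tendstoI)
  fix \<epsilon> :: real assume \<epsilon>: "0 < \<epsilon>"
  let ?FF = "Fl \<times>\<^sub>F nhds t" and ?rhs = "coag_rhs a s r (\<lambda>i. c i t) k"
  \<comment> \<open>Times above t / 2 and steps below t / 4 put the grid points beyond t /
    4.\<close>
  obtain B N where B: "0 \<le> B" "\<And>n j. N \<le> n \<Longrightarrow> t / 4 \<le> h n * real j \<Longrightarrow> mom n 2 (u n j) \<le> B"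
    using mom_bound[of "t/4" 2] assms by auto
  have "(\<lambda>m. M * (2 * A * real k * B) * (1 / real (m + 1))) \<longlonglongrightarrow> M * (2 * A * real k * B) * 0"
    using LIMSEQ_inverse_real_of_nat by (intro tendsto_mult_left) (simp add: inverse_eq_divide add.commute)
  then have "eventually (\<lambda>m. M * (2 * A * real k * B) / real (m + 1) < \<epsilon> / 3) sequentially"
    using \<epsilon> by (intro order_tendstoD(2)[of _ 0]) auto
  moreover have "eventually (\<lambda>m. dist (P m (\<lambda>i. c i t) k) ?rhs < \<epsilon> / 3) sequentially"
    using \<epsilon> by (intro tendstoD P_tendsto_rhs assms) auto
  ultimately obtain m where m: "M * (2 * A * real k * B) / real (m + 1) < \<epsilon> / 3"
      "dist (P m (\<lambda>i. c i t) k) ?rhs < \<epsilon> / 3"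
    using eventually_conj eventually_happens'[OF sequentially_bot] by fast
  have "((\<lambda>x. P m (\<lambda>i. U (fst x) i (snd x)) k) \<longlongrightarrow> P m (\<lambda>i. c i t) k) ?FF"
    unfolding P_def
    by (intro tendsto_intros U_tendsto_joint[unfolded case_prod_unfold]) (use assms in auto)
  then have "eventually (\<lambda>x. dist (P m (\<lambda>i. U (fst x) i (snd x)) k) (P m (\<lambda>i. c i t) k) < \<epsilon> / 3) ?FF"
    using \<epsilon> by (intro tendstoD) auto
  moreover have "eventually (\<lambda>x. h (fst x) < t / 4 \<and> max N (k + m) \<le> fst x) ?FF"
  proof -
    have "eventually (\<lambda>n. h n < t / 4) Fl"
      using h_tendsto_Fl assms by (intro order_tendstoD) auto
    then have "eventually (\<lambda>n. h n < t / 4 \<and> max N (k + m) \<le> n) Fl"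
      using eventually_Fl[OF eventually_ge_at_top[of "max N (k + m)"]] by (rule eventually_conj)
    then show ?thesis using filterlim_fst[of Fl "nhds t"] unfolding filterlim_iff by auto
  qed
  moreover have "eventually (\<lambda>x. t / 2 < snd x) ?FF"
  proof -
    have "eventually (\<lambda>t'. t' \<in> {t/2<..}) (nhds t)"
      using assms by (intro eventually_nhds_in_open) auto
    then show ?thesis using filterlim_snd[of "nhds t" Fl] unfolding filterlim_iff by auto
  qed
  ultimately show "eventually (\<lambda>x. dist (case x of (n,t') \<Rightarrow> F n (\<lambda>i. U n i t') k) ?rhs < \<epsilon>) ?FF"
  proof eventually_elim
    case (elim x)
    obtain n t' where x: "x = (n, t')" by (cases x)
    have "mom n 2 (u n (nat \<lfloor>t' / h n\<rfloor>)) \<le> B"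
      using B(2)[of n "nat \<lfloor>t' / h n\<rfloor>"] grid_bounds(1)[of t' n] elim x assms by simp
    then have "\<bar>F n (\<lambda>i. U n i t') k - P m (\<lambda>i. U n i t') k\<bar> < \<epsilon> / 3"
      using F_tail_bound[of n "nat \<lfloor>t' / h n\<rfloor>" B k m] elim x assms m(1) unfolding U_def by simp
    moreover have "\<bar>P m (\<lambda>i. U n i t') k - P m (\<lambda>i. c i t) k\<bar> < \<epsilon> / 3"
      using elim(1) by (simp add: x dist_real_def)
    moreover have "\<bar>P m (\<lambda>i. c i t) k - ?rhs\<bar> < \<epsilon> / 3"
      using m(2) by (simp add: dist_real_def)
    ultimately show ?case unfolding x dist_real_def prod.case by linarith
  qed
qed

text \<open>Joint convergence keeps \<open>F\<close> within \<epsilon> / 2 of its limit at all grid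
  times near \<open>t\<close>, eventually along \<open>Fl\<close>. Then \<open>c_increment\<close>
  bounds the deviation of the difference quotients from either side.\<close>

lemma c_derivative:
  assumes "0 < t" "1 \<le> k"
  shows "(c k has_real_derivative coag_rhs a s r (\<lambda>i. c i t) k) (at t)"
proof -
  let ?G = "coag_rhs a s r (\<lambda>i. c i t) k"
  have "((\<lambda>y. (c k y - c k t) / (y - t)) \<longlongrightarrow> ?G) (at t)"
  proof (rule tendstoI)
    fix \<epsilon> :: real assume \<epsilon>: "0 < \<epsilon>"
    have "eventually (\<lambda>(n,t'). dist (F n (\<lambda>i. U n i t') k) ?G < \<epsilon> / 2) (Fl \<times>\<^sub>F nhds t)"
      using tendstoD[OF F_tendsto_joint[OF assms], of "\<epsilon>/2"] \<epsilon> by (simp add: case_prod_unfold)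
    then obtain Pf Pg where Pf: "eventually Pf Fl" and Pg: "eventually Pg (nhds t)"
      and PP: "\<And>n t'. Pf n \<Longrightarrow> Pg t' \<Longrightarrow> dist (F n (\<lambda>i. U n i t') k) ?G < \<epsilon> / 2"
      unfolding eventually_prod_filter by auto
    obtain d0 where d0: "0 < d0" "\<And>t'. dist t' t < d0 \<Longrightarrow> Pg t'"
      using Pg unfolding eventually_nhds_metric by blast
    \<comment> \<open>Grid times may reach one step, less than \<open>d\<close>, below t1 > t - d;
      half of \<open>d0\<close> keeps them within distance \<open>d0\<close> of \<open>t\<close>.
      The bound t / 2 keeps t1 positive.\<close>
    define d where "d = min (d0 / 2) (t / 2)"
    have d: "0 < d" "d \<le> d0 / 2" "d \<le> t / 2" using d0 assms by (auto simp: d_def)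
    have inc: "\<bar>c k t2 - c k t1 - (t2 - t1) * ?G\<bar> \<le> (t2 - t1) * (\<epsilon> / 2)"
      if "t - d < t1" "t1 \<le> t2" "t2 < t + d" for t1 t2
    proof (rule c_increment)
      have "eventually (\<lambda>n. h n < d) Fl" using h_tendsto_Fl d by (intro order_tendstoD) auto
      then show "eventually (\<lambda>n. \<forall>j. t1 - h n < h n * real j \<longrightarrow> h n * real j \<le> t2 \<longrightarrow> \<bar>F n (u n j) k - ?G\<bar> \<le> \<epsilon> / 2) Fl"
        using Pf
      proof eventually_elim
        case (elim n)
        show ?case
        proof (intro allI impI)
          fix j assume j: "t1 - h n < h n * real j" "h n * real j \<le> t2"
          have "U n i (h n * real j) = u n j i" for i
            using h_pos[of n] by (simp add: U_def)
          moreover have "dist (h n * real j) t < d0"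
            using j elim that d by (simp add: dist_real_def abs_less_iff)
          ultimately show "\<bar>F n (u n j) k - ?G\<bar> \<le> \<epsilon> / 2"
            using PP[OF elim(2) d0(2), of "h n * real j"] by (simp add: dist_real_def)
        qed
      qed
    qed (use that d assms in auto)
    have "eventually (\<lambda>y. dist y t < d \<and> y \<noteq> t) (at t)"
      using d(1) unfolding eventually_at by auto
    then show "eventually (\<lambda>y. dist ((c k y - c k t) / (y - t)) ?G < \<epsilon>) (at t)"
    proof eventually_elim
      case (elim y)
      have "\<bar>c k y - c k t - (y - t) * ?G\<bar> \<le> \<bar>y - t\<bar> * (\<epsilon> / 2)"
      proof (cases "t \<le> y")
        case True
        then show ?thesis using inc[of t y] elim d by (auto simp: dist_real_def)
      next
        case False
        then have "\<bar>c k t - c k y - (t - y) * ?G\<bar> \<le> (t - y) * (\<epsilon> / 2)"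
          using inc[of y t] elim d by (auto simp: dist_real_def)
        moreover have "c k y - c k t - (y - t) * ?G = - (c k t - c k y - (t - y) * ?G)"
          by (simp add: algebra_simps)
        ultimately show ?thesis using False by (simp only: abs_minus_cancel) simp
      qed
      moreover have "(c k y - c k t) / (y - t) - ?G = (c k y - c k t - (y - t) * ?G) / (y - t)"
        using elim by (simp add: field_simps)
      ultimately have "\<bar>(c k y - c k t) / (y - t) - ?G\<bar> \<le> \<epsilon> / 2"
        using elim by (simp add: abs_divide pos_divide_le_eq mult.commute)
      then show ?case using \<epsilon> by (simp add: dist_real_def)
    qed
  qed
  then show ?thesis by (simp add: has_field_derivative_iff)
qed

subsection \<open>Regularity of the limit\<close>

definition d where "d t k = coag_rhs a s r (\<lambda>i. c i t) k"

definition gain where "gain t k = (1/2) * (\<Sum>l\<in>{1..<k}. a (k - l) l * c (k - l) t * c l t)"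

definition loss where "loss t k = (\<Sum>\<^sub>\<infinity>l\<in>{1..}. a k l * c l t)"

lemma d_eq: "d t k = gain t k - c k t * loss t k + s k - r k * c k t"
  by (simp add: d_def coag_rhs_def gain_def loss_def)

lemma c_decay:
  assumes "0 < t0"
  shows "\<exists>C\<ge>0. \<forall>t\<ge>t0. \<forall>k\<ge>1. real k powr p * c k t \<le> C"
proof -
  obtain B where B: "0 \<le> B" "\<And>t N. t0 \<le> t \<Longrightarrow> (\<Sum>k=1..N. real k powr p * c k t) \<le> B"
    using c_moments[OF assms, of p] by blast
  have "real k powr p * c k t \<le> B" if "t0 \<le> t" "1 \<le> k" for t k
  proof -
    have "real k powr p * c k t \<le> (\<Sum>k=1..k. real k powr p * c k t)"
      using that c_nonneg by (intro member_le_sum) auto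
    then show ?thesis using B(2)[OF that(1)] order_trans by blast
  qed
  then show ?thesis using B(1) by blast
qed

lemma gain_nonneg: "0 \<le> gain t k"
  unfolding gain_def using a_nonneg c_nonneg
  by (intro mult_nonneg_nonneg sum_nonneg) auto

lemma loss_nonneg: "1 \<le> k \<Longrightarrow> 0 \<le> loss t k"
  unfolding loss_def using a_nonneg c_nonneg by (intro infsum_nonneg) auto

lemma loss_le:
  assumes "1 \<le> k"
  shows "loss t k \<le> 2 * A * real k * M"
  unfolding loss_def
proof (rule summable_on_from_partial_sums(2))
  fix N
  have "(\<Sum>l=1..N. a k l * c l t) \<le> (\<Sum>l=1..N. 2 * A * real k * (real l powr 1 * c l t))"
  proof (rule sum_mono)
    fix l assume "l \<in> {1..N}"
    then have "a k l * c l t \<le> (2 * A * real k * real l) * c l t"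
      using a_le[of k l] assms c_nonneg by (intro mult_right_mono) auto
    then show "a k l * c l t \<le> 2 * A * real k * (real l powr 1 * c l t)" by (simp add: mult.assoc)
  qed
  also have "\<dots> = 2 * A * real k * (\<Sum>l=1..N. real l powr 1 * c l t)"
    by (rule sum_distrib_left[symmetric])
  also have "\<dots> \<le> 2 * A * real k * M"
    using A_pos by (intro mult_left_mono c_mass) auto
  finally show "(\<Sum>l=1..N. a k l * c l t) \<le> 2 * A * real k * M" .
qed (use a_nonneg c_nonneg assms in auto)

\<comment> \<open>In a pair of sizes adding up to k, one is at least k/2 and its concentration decays fast.\<close>
lemma gain_decay:
  assumes "0 < t0" "0 \<le> p"
  shows "\<exists>C\<ge>0. \<forall>t\<ge>t0. \<forall>k\<ge>1. real k powr p * gain t k \<le> C"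
proof -
  \<comment> \<open>Two of the three extra orders pay for the rate, which is at most 2 A k k, and
    the third for the fewer than \<open>k\<close> pairs.\<close>
  let ?q = "p + 3"
  obtain C where C: "0 \<le> C" "\<And>t k. t0 \<le> t \<Longrightarrow> 1 \<le> k \<Longrightarrow> real k powr ?q * c k t \<le> C"
    using c_decay[OF assms(1), of ?q] by blast
  define D where "D = 2 powr ?q * C * M"
  have D: "0 \<le> D" using C(1) M_nonneg by (simp add: D_def)
  have half: "real k powr ?q * (c i t * c j t) \<le> D" if "t0 \<le> t" "1 \<le> i" "k \<le> 2 * i" for t k i j
  proof -
    have "real k powr ?q \<le> (2 * real i) powr ?q"
      using that assms by (intro powr_mono2) auto
    also have "\<dots> = 2 powr ?q * real i powr ?q" by (simp add: powr_mult)
    finally have "real k powr ?q * (c i t * c j t) \<le> 2 powr ?q * real i powr ?q * (c i t * c j t)"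
      using c_nonneg by (intro mult_right_mono mult_nonneg_nonneg) auto
    also have "\<dots> = 2 powr ?q * ((real i powr ?q * c i t) * c j t)" by simp
    also have "\<dots> \<le> 2 powr ?q * (C * M)"
      using C that c_le_M c_nonneg by (intro mult_left_mono mult_mono) auto
    finally show ?thesis by (simp add: D_def)
  qed
  have "real k powr p * gain t k \<le> A * D" if t: "t0 \<le> t" and k: "1 \<le> k" for t k
  proof -
    have "real k powr p * (a (k - l) l * c (k - l) t * c l t) \<le> 2 * A * D / real k" if l: "l \<in> {1..<k}" for l
    proof -
      have "real k powr ?q * (c (k - l) t * c l t) \<le> D"
      proof (cases "k \<le> 2 * l")
        case True
        then show ?thesis using half[of t l k "k - l"] t l by (simp add: mult.commute)
      next
        case False
        then show ?thesis using half[of t "k - l" k l] t l by auto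
      qed
      moreover have "real k powr ?q = real k powr p * real k ^ 3"
        using k by (simp add: powr_add powr_numeral)
      ultimately have 1: "real k * (real k powr p * (real k * real k) * (c (k - l) t * c l t)) \<le> D"
        by (simp add: power3_eq_cube mult_ac)
      have "a (k - l) l \<le> 2 * A * real (k - l) * real l"
        using a_le[of "k - l" l] l by auto
      also have "\<dots> \<le> 2 * A * real k * real k"
        using A_pos l by (intro mult_mono) auto
      finally have "a (k - l) l * (real k powr p * (c (k - l) t * c l t)) \<le> 2 * A * real k * real k * (real k powr p * (c (k - l) t * c l t))"
        using c_nonneg by (intro mult_right_mono mult_nonneg_nonneg) auto
      then have "real k * (a (k - l) l * (real k powr p * (c (k - l) t * c l t)))
          \<le> real k * (2 * A * real k * real k * (real k powr p * (c (k - l) t * c l t)))"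
        by (rule mult_left_mono) simp
      also have "\<dots> = 2 * A * (real k * (real k powr p * (real k * real k) * (c (k - l) t * c l t)))"
        by simp
      also have "\<dots> \<le> 2 * A * D"
        using 1 A_pos by (intro mult_left_mono) auto
      finally show ?thesis using k by (simp add: pos_le_divide_eq mult_ac)
    qed
    then have "(\<Sum>l\<in>{1..<k}. real k powr p * (a (k - l) l * c (k - l) t * c l t)) \<le> (\<Sum>l\<in>{1..<k}. 2 * A * D / real k)"
      by (rule sum_mono)
    also have "\<dots> = (real (k - 1) / real k) * (2 * A * D)" by simp
    also have "\<dots> \<le> 1 * (2 * A * D)"
      using A_pos D k by (intro mult_right_mono) auto
    finally show ?thesis
      unfolding gain_def by (simp add: sum_distrib_left[symmetric])
  qed
  moreover have "0 \<le> A * D" using A_pos D by simp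
  ultimately show ?thesis by blast
qed

lemma c_has_derivative_d: "0 < t \<Longrightarrow> 1 \<le> k \<Longrightarrow> (c k has_real_derivative d t k) (at t)"
  unfolding d_def by (rule c_derivative)

text \<open>Moments alone cannot control \<open>r k * c k t\<close>, as \<open>r\<close> may grow
  arbitrarily fast. Dropping the loss term leaves a linear inequality with relaxation rate
  \<open>r k\<close> and a rapidly decaying source, and \<open>relaxation_bound\<close> started at
  t0 / 2 gives a bound free of \<open>r\<close>.\<close>

lemma removal_decay:
  assumes "0 < t0" "0 \<le> p"
  shows "\<exists>C\<ge>0. \<forall>t\<ge>t0. \<forall>k\<ge>1. real k powr p * (r k * c k t) \<le> C"
proof -
  let ?t1 = "t0 / 2"
  have t1: "0 < ?t1" using assms by simp
  obtain Cg where Cg: "0 \<le> Cg" "\<And>t k. ?t1 \<le> t \<Longrightarrow> 1 \<le> k \<Longrightarrow> real k powr p * gain t k \<le> Cg"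
    using gain_decay[OF t1 assms(2)] by blast
  obtain Cc where Cc: "0 \<le> Cc" "\<And>t k. ?t1 \<le> t \<Longrightarrow> 1 \<le> k \<Longrightarrow> real k powr p * c k t \<le> Cc"
    using c_decay[OF t1, of p] by blast
  have "real k powr p * (r k * c k t) \<le> Cg + S p + Cc / ?t1" if t: "t0 \<le> t" and k: "1 \<le> k" for t k
  proof -
    let ?w = "real k powr p"
    have w: "0 < ?w" using k by simp
    have "r k * c k t \<le> (Cg + S p) / ?w + c k ?t1 / (t - ?t1)"
    proof (rule relaxation_bound[of ?t1 "c k" "\<lambda>x. d x k"])
      fix x assume x: "?t1 \<le> x"
      then show "(c k has_real_derivative d x k) (at x)"
        using c_has_derivative_d[of x k] assms k by simp
      have "?w * (gain x k + s k) \<le> Cg + S p"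
        using Cg(2)[OF x k] source_le[OF assms(2) k] by (simp add: distrib_left)
      then have "gain x k + s k \<le> (Cg + S p) / ?w"
        using w by (simp add: pos_le_divide_eq mult.commute)
      moreover have "0 \<le> c k x * loss x k" using c_nonneg loss_nonneg[OF k] by simp
      ultimately show "d x k \<le> (Cg + S p) / ?w - r k * c k x"
        unfolding d_eq by linarith
    qed (use r_pos[OF k] Cg(1) S_nonneg c_nonneg t assms in auto)
    then have "?w * (r k * c k t) \<le> ?w * ((Cg + S p) / ?w + c k ?t1 / (t - ?t1))"
      using w by (intro mult_left_mono) auto
    also have "\<dots> = ?w * ((Cg + S p) / ?w) + (?w * c k ?t1) / (t - ?t1)"
      by (simp only: distrib_left times_divide_eq_right)
    also have "?w * ((Cg + S p) / ?w) = Cg + S p"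
      using w by simp
    also have "(?w * c k ?t1) / (t - ?t1) \<le> Cc / ?t1"
      using Cc(2)[of ?t1 k] k t assms Cc(1) by (intro frac_le) auto
    finally show ?thesis by simp
  qed
  moreover have "0 \<le> Cg + S p + Cc / ?t1" using Cg(1) Cc(1) S_nonneg t1 by (simp add: divide_nonneg_pos)
  ultimately show ?thesis by blast
qed

lemma d_decay:
  assumes "0 < t0" "0 \<le> p"
  shows "\<exists>C\<ge>0. \<forall>t\<ge>t0. \<forall>k\<ge>1. real k powr p * \<bar>d t k\<bar> \<le> C"
proof -
  obtain Cg where Cg: "0 \<le> Cg" "\<And>t k. t0 \<le> t \<Longrightarrow> 1 \<le> k \<Longrightarrow> real k powr p * gain t k \<le> Cg"
    using gain_decay[OF assms] by blast
  \<comment> \<open>The extra order pays for the factor \<open>k\<close> in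
    \<open>loss_le\<close>.\<close>
  obtain Cc where Cc: "0 \<le> Cc" "\<And>t k. t0 \<le> t \<Longrightarrow> 1 \<le> k \<Longrightarrow> real k powr (p + 1) * c k t \<le> Cc"
    using c_decay[OF assms(1), of "p + 1"] by blast
  obtain Cr where Cr: "0 \<le> Cr" "\<And>t k. t0 \<le> t \<Longrightarrow> 1 \<le> k \<Longrightarrow> real k powr p * (r k * c k t) \<le> Cr"
    using removal_decay[OF assms] by blast
  have "real k powr p * \<bar>d t k\<bar> \<le> Cg + 2 * A * M * Cc + S p + Cr" if t: "t0 \<le> t" and k: "1 \<le> k" for t k
  proof -
    let ?w = "real k powr p"
    have "\<bar>d t k\<bar> \<le> gain t k + c k t * loss t k + s k + r k * c k t"
      unfolding d_eq using gain_nonneg[of t k] c_nonneg[of k t] loss_nonneg[OF k, of t] s_nonneg[OF k] r_pos[OF k]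
      by (intro abs_leI) (auto simp: algebra_simps intro!: add_nonneg_nonneg)
    then have "?w * \<bar>d t k\<bar> \<le> ?w * (gain t k + c k t * loss t k + s k + r k * c k t)"
      by (intro mult_left_mono) auto
    also have "\<dots> = ?w * gain t k + ?w * (c k t * loss t k) + ?w * s k + ?w * (r k * c k t)"
      by (simp add: distrib_left)
    also have "?w * (c k t * loss t k) \<le> 2 * A * M * Cc"
    proof -
      have "?w * (c k t * loss t k) \<le> ?w * (c k t * (2 * A * real k * M))"
        using loss_le[OF k] c_nonneg by (intro mult_left_mono) auto
      also have "\<dots> = 2 * A * M * (real k powr (p + 1) * c k t)"
        using k by (simp add: powr_add)
      also have "\<dots> \<le> 2 * A * M * Cc"
        using Cc(2)[OF t k] A_pos M_nonneg by (intro mult_left_mono) auto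
      finally show ?thesis .
    qed
    finally show ?thesis
      using Cg(2)[OF t k] source_le[OF assms(2) k] Cr(2)[OF t k] by linarith
  qed
  moreover have "0 \<le> Cg + 2 * A * M * Cc + S p + Cr"
    using Cg(1) Cc(1) Cr(1) S_nonneg A_pos M_nonneg by simp
  ultimately show ?thesis by blast
qed

lemma c_isCont: "0 < t \<Longrightarrow> 1 \<le> k \<Longrightarrow> (c k \<longlongrightarrow> c k t) (at t)"
  using DERIV_isCont[OF c_derivative] by (simp add: isCont_def)

lemma eventually_at_half: "0 < t \<Longrightarrow> eventually (\<lambda>\<tau>. t / 2 \<le> \<tau>) (at t)" for t :: real
  using eventually_at_topological[of "\<lambda>\<tau>. t / 2 \<le> \<tau>" t UNIV]
  by (auto intro!: exI[of _ "{t/2<..}"])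

lemma d_tendsto:
  assumes t: "0 < t" and k: "1 \<le> k"
  shows "((\<lambda>\<tau>. d \<tau> k) \<longlongrightarrow> d t k) (at t)"
proof -
  \<comment> \<open>Order 3, because the rate is at most linear in \<open>l\<close> and
    \<open>l powr -2\<close> must remain as majorant.\<close>
  obtain C where C: "0 \<le> C" "\<And>\<tau> l. t / 2 \<le> \<tau> \<Longrightarrow> 1 \<le> l \<Longrightarrow> real l powr 3 * c l \<tau> \<le> C"
    using c_decay[of "t/2" 3] t by auto
  have "((\<lambda>\<tau>. \<Sum>\<^sub>\<infinity>l\<in>{1..}. a k l * c l \<tau>) \<longlongrightarrow> (\<Sum>\<^sub>\<infinity>l\<in>{1..}. a k l * c l t)) (at t)"
  proof (rule infsum_dominated_tendsto[OF _ _ summable_on_inverse_square])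
    show "eventually (\<lambda>\<tau>. \<forall>l\<ge>1. \<bar>a k l * c l \<tau>\<bar> \<le> (2 * A * real k * C) * real l powr -2) (at t)"
      using eventually_at_half[OF t]
    proof eventually_elim
      case (elim \<tau>)
      show ?case
      proof (intro allI impI)
        fix l :: nat assume l: "1 \<le> l"
        have "\<bar>a k l * c l \<tau>\<bar> = a k l * c l \<tau>"
          using a_nonneg[OF k l] c_nonneg by simp
        also have "\<dots> \<le> (2 * A * real k * real l) * c l \<tau>"
          using a_le[OF k l] c_nonneg by (intro mult_right_mono) auto
        also have "\<dots> = 2 * A * real k * ((real l powr 3 * c l \<tau>) * real l powr -2)"
          using l by (simp add: powr_minus powr_numeral field_simps power2_eq_square power3_eq_cube)
        also have "\<dots> \<le> 2 * A * real k * (C * real l powr -2)"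
          using C(2)[OF elim l] A_pos by (intro mult_left_mono mult_right_mono) auto
        finally show "\<bar>a k l * c l \<tau>\<bar> \<le> (2 * A * real k * C) * real l powr -2"
          by (simp add: mult.assoc)
      qed
    qed
  qed (use t c_isCont in \<open>auto intro!: tendsto_intros\<close>)
  then show ?thesis
    unfolding d_def coag_rhs_def
    by (intro tendsto_intros c_isCont) (use t k in auto)
qed

text \<open>Two spare orders of uniform decay supply a summable majorant, so convergence of each
  coordinate implies convergence in norm.\<close>

lemma wnorm_tendsto_0:
  assumes lim: "\<And>k. 1 \<le> k \<Longrightarrow> ((\<lambda>x. f x k) \<longlongrightarrow> 0) Fi"
    and bound: "eventually (\<lambda>x. \<forall>k\<ge>1. real k powr (\<mu> + 2) * \<bar>f x k\<bar> \<le> C) Fi"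
  shows "((\<lambda>x. wnorm \<mu> (f x)) \<longlongrightarrow> 0) Fi"
proof -
  have "((\<lambda>x. \<Sum>\<^sub>\<infinity>k\<in>{1..}. real k powr \<mu> * \<bar>f x k\<bar>) \<longlongrightarrow> (\<Sum>\<^sub>\<infinity>k\<in>{1::nat..}. 0)) Fi"
  proof (rule infsum_dominated_tendsto[OF _ _ summable_on_inverse_square])
    fix k :: nat assume "1 \<le> k"
    from tendsto_mult_left[OF tendsto_rabs_zero[OF lim[OF this]], of "real k powr \<mu>"]
    show "((\<lambda>x. real k powr \<mu> * \<bar>f x k\<bar>) \<longlongrightarrow> 0) Fi" by simp
  next
    show "eventually (\<lambda>x. \<forall>k\<ge>1. \<bar>real k powr \<mu> * \<bar>f x k\<bar>\<bar> \<le> C * real k powr -2) Fi"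
      using bound
    proof eventually_elim
      case (elim x)
      show ?case
      proof (intro allI impI)
        fix k :: nat assume k: "1 \<le> k"
        have "\<bar>real k powr \<mu> * \<bar>f x k\<bar>\<bar> = (real k powr (\<mu> + 2) * \<bar>f x k\<bar>) * real k powr -2"
          using k by (simp add: powr_add powr_minus abs_mult)
        also have "\<dots> \<le> C * real k powr -2"
          using elim k by (intro mult_right_mono) auto
        finally show "\<bar>real k powr \<mu> * \<bar>f x k\<bar>\<bar> \<le> C * real k powr -2" .
      qed
    qed
  qed
  then show ?thesis by (simp add: wnorm_def)
qed

text \<open>The mean value theorem replaces the quotient by a derivative at a time at least t / 2,
  where \<open>d_decay\<close> is uniform; quotients thus have the same decay in \<open>k\<close> as
  \<open>d\<close>. The intermediate time may depend on \<open>k\<close>.\<close>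

lemma difference_quotient:
  assumes "0 < t" "1 \<le> k" "\<bar>\<tau>\<bar> < t / 2" "\<tau> \<noteq> 0"
  shows "\<exists>\<xi>\<ge>t/2. (c k (t + \<tau>) - c k t) / \<tau> = d \<xi> k"
proof (cases "0 < \<tau>")
  case True
  have "\<exists>z. t < z \<and> z < t + \<tau> \<and> c k (t + \<tau>) - c k t = (t + \<tau> - t) * d z k"
    using True assms by (intro MVT2 c_has_derivative_d) auto
  then obtain z where z: "t < z" "c k (t + \<tau>) - c k t = (t + \<tau> - t) * d z k" by blast
  then have "(c k (t + \<tau>) - c k t) / \<tau> = d z k"
    using True by simp
  moreover have "t / 2 \<le> z" using z(1) assms by linarith
  ultimately show ?thesis by blast
next
  case False
  have "\<exists>z. t + \<tau> < z \<and> z < t \<and> c k t - c k (t + \<tau>) = (t - (t + \<tau>)) * d z k"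
    using False assms by (intro MVT2 c_has_derivative_d) auto
  then obtain z where z: "t + \<tau> < z" "c k t - c k (t + \<tau>) = (t - (t + \<tau>)) * d z k" by blast
  then have "(c k (t + \<tau>) - c k t) / \<tau> = d z k"
    using assms by (simp add: field_simps)
  moreover have "t / 2 \<le> z" using z(1) assms by linarith
  ultimately show ?thesis by blast
qed

text \<open>With \<open>d\<close> as derivative, both limits reduce to
  \<open>wnorm_tendsto_0\<close>: coordinates converge by \<open>c_has_derivative_d\<close> and
  \<open>d_tendsto\<close>, and \<open>d_decay\<close> at order \<mu> + 2 supplies the uniform
  bound.\<close>

lemma c_C1: "1 \<le> \<mu> \<Longrightarrow> C1_ell1 \<mu> c"
  unfolding C1_ell1_def
proof (intro exI[of _ d] allI impI conjI)
  fix t :: real assume \<mu>: "1 \<le> \<mu>" and t: "0 < t"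
  obtain C where C: "0 \<le> C" "\<And>\<tau> k. t / 2 \<le> \<tau> \<Longrightarrow> 1 \<le> k \<Longrightarrow> real k powr (\<mu> + 2) * \<bar>d \<tau> k\<bar> \<le> C"
    using d_decay[of "t/2" "\<mu> + 2"] t \<mu> by auto
  have diff: "real k powr (\<mu> + 2) * \<bar>d \<xi> k - d t k\<bar> \<le> 2 * C" if "t / 2 \<le> \<xi>" "1 \<le> k" for \<xi> k
  proof -
    have "real k powr (\<mu> + 2) * \<bar>d \<xi> k - d t k\<bar> \<le> real k powr (\<mu> + 2) * (\<bar>d \<xi> k\<bar> + \<bar>d t k\<bar>)"
      by (intro mult_left_mono) auto
    then show ?thesis
      using C(2)[OF that] C(2)[of t k] that t by (simp add: distrib_left)
  qed
  show "wsummable \<mu> (\<lambda>k. c k t)"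
    unfolding wsummable_def using moment_summable[OF t, of \<mu>] c_nonneg by simp
  show "wsummable \<mu> (d t)"
    unfolding wsummable_def
  proof (rule summable_on_comparison_test[OF summable_on_inverse_square[of C]])
    fix k :: nat assume k: "k \<in> {1..}"
    have "real k powr \<mu> * \<bar>d t k\<bar> = (real k powr (\<mu> + 2) * \<bar>d t k\<bar>) * real k powr -2"
      using k by (simp add: powr_add powr_minus)
    also have "\<dots> \<le> C * real k powr -2"
      using C(2)[of t k] k t by (intro mult_right_mono) auto
    finally show "real k powr \<mu> * \<bar>d t k\<bar> \<le> C * real k powr -2" .
  qed simp
  show "((\<lambda>\<tau>. wnorm \<mu> (\<lambda>k. (c k (t + \<tau>) - c k t) / \<tau> - d t k)) \<longlongrightarrow> 0) (at 0)"
  proof (rule wnorm_tendsto_0)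
    fix k :: nat assume "1 \<le> k"
    then have "((\<lambda>\<tau>. (c k (t + \<tau>) - c k t) / \<tau>) \<longlongrightarrow> d t k) (at 0)"
      using c_has_derivative_d[OF t] by (simp add: DERIV_def)
    then show "((\<lambda>\<tau>. (c k (t + \<tau>) - c k t) / \<tau> - d t k) \<longlongrightarrow> 0) (at 0)"
      by (simp add: LIM_zero_iff)
  next
    have "eventually (\<lambda>\<tau>::real. \<bar>\<tau>\<bar> < t / 2 \<and> \<tau> \<noteq> 0) (at 0)"
      unfolding eventually_at using t by (intro exI[of _ "t/2"]) (auto simp: dist_real_def)
    then show "eventually (\<lambda>\<tau>. \<forall>k\<ge>1. real k powr (\<mu> + 2) * \<bar>(c k (t + \<tau>) - c k t) / \<tau> - d t k\<bar> \<le> 2 * C) (at 0)"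
    proof eventually_elim
      case (elim \<tau>)
      then show ?case using difference_quotient[OF t] diff by metis
    qed
  qed
  show "((\<lambda>\<tau>. wnorm \<mu> (\<lambda>k. d \<tau> k - d t k)) \<longlongrightarrow> 0) (at t)"
  proof (rule wnorm_tendsto_0)
    show "((\<lambda>\<tau>. d \<tau> k - d t k) \<longlongrightarrow> 0) (at t)" if "1 \<le> k" for k
      using d_tendsto[OF t that] by (simp add: LIM_zero_iff)
    show "eventually (\<lambda>\<tau>. \<forall>k\<ge>1. real k powr (\<mu> + 2) * \<bar>d \<tau> k - d t k\<bar> \<le> 2 * C) (at t)"
      using eventually_at_half[OF t] by eventually_elim (use diff in blast)
  qed
qed

lemma c_global_solution: "global_solution a s r cin c"
  unfolding global_solution_def
proof (intro conjI allI impI exI[of _ M])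
  fix t :: real assume "0 \<le> t"
  have "(\<lambda>k. real k powr 1 * c k t) summable_on {1..}" "(\<Sum>\<^sub>\<infinity>k\<in>{1..}. real k powr 1 * c k t) \<le> M"
    using summable_on_from_partial_sums[of "\<lambda>k. real k powr 1 * c k t", OF _ c_mass] c_nonneg by auto
  then show "wsummable 1 (\<lambda>k. c k t)" "wnorm 1 (\<lambda>k. c k t) \<le> M"
    unfolding wsummable_def wnorm_def using c_nonneg by simp_all
qed (auto intro: c_continuous c_nonneg c_derivative c_C1 c_initial)

end

section \<open>Existence of a global solution\<close>

context coagulation
begin

lemma global_solution_exists: "\<exists>c. global_solution a s r cin c"
proof -
  \<comment> \<open>The index set consists of all pairs of a size and a time, so one application
    yields a single filter for all of them.\<close>
  have "\<exists>Fl c. Fl \<noteq> bot \<and> Fl \<le> sequentially \<and> (\<forall>i. ((\<lambda>n. case i of (k, t) \<Rightarrow> U n k t) \<longlongrightarrow> c i) Fl)"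
    by (rule bounded_functions_cluster[of _ 0 M]) (auto simp: U_def u_nonneg u_le_M)
  then obtain Fl c where Fl: "Fl \<noteq> bot" "Fl \<le> sequentially"
    and lim: "\<And>i. ((\<lambda>n. case i of (k, t) \<Rightarrow> U n k t) \<longlongrightarrow> c i) Fl"
    by blast
  interpret coagulation_limit a r s cin A R \<alpha> \<beta> \<gamma> Fl "\<lambda>k t. c (k, t)"
    by unfold_locales (use Fl lim[of "(_, _)"] in auto)
  show ?thesis using c_global_solution by blast
qed

end

theorem mainTheorem1:
  fixes a :: "nat \<Rightarrow> nat \<Rightarrow> real" and r s cin :: "nat \<Rightarrow> real"
    and A R \<alpha> \<beta> \<gamma> :: real
  assumes A_pos: "A > 0"
    and alpha_beta: "0 \<le> \<alpha>" "\<alpha> \<le> \<beta>" "\<beta> \<le> 1"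
    and a_sym: "\<And>k l. k \<ge> 1 \<Longrightarrow> l \<ge> 1 \<Longrightarrow> a k l = a l k"
    and a_nonneg: "\<And>k l. k \<ge> 1 \<Longrightarrow> l \<ge> 1 \<Longrightarrow> 0 \<le> a k l"
    and a_bound: "\<And>k l. k \<ge> 1 \<Longrightarrow> l \<ge> 1 \<Longrightarrow>
        a k l \<le> A * (real k powr \<alpha> * real l powr \<beta> + real k powr \<beta> * real l powr \<alpha>)"
    and R_pos: "R > 0"
    and gamma: "\<gamma> > 0" "\<gamma> > \<alpha> + \<beta> - 1"
    and r_bound: "\<And>k. k \<ge> 1 \<Longrightarrow> r k \<ge> R * real k powr \<gamma>"
    and s_nonneg: "\<And>k. k \<ge> 1 \<Longrightarrow> s k \<ge> 0"
    and s_moments: "\<And>\<mu>. \<mu> \<ge> 0 \<Longrightarrow> \<exists>S>0. (\<lambda>k. real k powr \<mu> * s k) summable_on {1..}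
                                          \<and> (\<Sum>\<^sub>\<infinity>k\<in>{1..}. real k powr \<mu> * s k) \<le> S"
    and cin: "in_ell1 1 cin"
  shows "\<exists>c. global_solution a s r cin c"
proof -
  interpret coagulation a r s cin A R \<alpha> \<beta> \<gamma>
    by unfold_locales (use assms in blast)+
  show ?thesis by (rule global_solution_exists)
qed

end
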